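(* There exists a constant $C>0$ such that for all integers $n,r$ with $n\ge 2r-1\ge 3$ there exists an $n$-vertex $r$-uniform critical hypergraph with at most $\max\{(n/r)^{C r^2/n},\, C r\}$ edges.
   Context: A hypergraph is $r$-uniform if all edges have exactly $r$ vertices; it is intersecting if any two edges intersect; its cover number is the minimum size of a vertex set meeting every edge. An $r$-uniform hypergraph is called critical if it is intersecting and has cover number equal to $r$. *)

theory Defs
  imports Complex_Main
begin

text \<open>A hypergraph is a pair of a finite vertex set \<open>V\<close> and a set \<open>E\<close> of edges (no repeated
  edges).  Isolated vertices are allowed.\<close>

definition hypergraph :: "'a set \<Rightarrow> 'a set set \<Rightarrow> bool" where
  "hypergraph V E \<longleftrightarrow> finite V \<and> (\<forall>e\<in>E. e \<subseteq> V)"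

definition uniform :: "nat \<Rightarrow> 'a set set \<Rightarrow> bool" where
  "uniform r E \<longleftrightarrow> (\<forall>e\<in>E. card e = r)"

definition intersecting :: "'a set set \<Rightarrow> bool" where
  "intersecting E \<longleftrightarrow> (\<forall>e\<in>E. \<forall>f\<in>E. e \<inter> f \<noteq> {})"

definition vertex_cover :: "'a set \<Rightarrow> 'a set set \<Rightarrow> 'a set \<Rightarrow> bool" where
  "vertex_cover V E T \<longleftrightarrow> T \<subseteq> V \<and> (\<forall>e\<in>E. T \<inter> e \<noteq> {})"

text \<open>The minimum is attained whenever all edges are nonempty subsets of \<open>V\<close>, since then \<open>V\<close>
  itself is a cover; without any cover the value of \<open>LEAST\<close> is unspecified.\<close>

definition cover_number :: "'a set \<Rightarrow> 'a set set \<Rightarrow> nat" where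
  "cover_number V E = (LEAST k. \<exists>T. vertex_cover V E T \<and> card T = k)"

definition critical :: "nat \<Rightarrow> 'a set \<Rightarrow> 'a set set \<Rightarrow> bool" where
  "critical r V E \<longleftrightarrow>
     hypergraph V E \<and> uniform r E \<and> intersecting E \<and> cover_number V E = r"

end

theory Submission
  imports Defs "HOL-Library.FuncSet" "HOL-Number_Theory.Cong"
begin

text \<open>For large \<open>n\<close> the bound asks for \<open>r\<close>-uniform critical hypergraphs with \<open>O(r)\<close> edges (Kahn's
  theorem). They are built by recursion on \<open>r = n + R\<close>, where \<open>n\<close> is a multiple of a fixed large
  prime \<open>q\<close> and \<open>R\<close> is about \<open>3 * r / q\<close>, from a critical \<open>R\<close>-uniform \<open>H\<close> on new vertices.

  Arrange \<open>O(n)\<close> rows in \<open>n + R\<close> columns. Every column is a partition of the rows into \<open>n\<close> parts, and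
  any two rows share a part of some column. The parts are the new vertices; a row is the set of the
  \<open>n + R\<close> parts containing it. The other edges are \<open>p \<union> h\<close> with \<open>p\<close> the set of all \<open>n\<close> parts of one
  column and \<open>h \<in> H\<close>, for sparsely chosen pairs. Any two edges meet.

  Rows are pairs of a class \<open>c < q\<close> and an edge \<open>(z, y)\<close> of a bounded degree expander on \<open>{..<n}\<close>. The
  first \<open>n\<close> columns only look at \<open>(c, z)\<close> and the last \<open>R\<close> only at \<open>(c, y)\<close>, and each part contains at most
  \<open>q\<close> such pairs. By expansion, mixing parts of the two kinds is wasteful: if \<open>t\<^sub>1\<close> and \<open>t\<^sub>2\<close> parts
  of the two kinds cover all rows and \<open>t\<^sub>1 + t\<^sub>2 < n + j\<close>, then \<open>t\<^sub>1\<close> or \<open>t\<^sub>2\<close> is at most \<open>2 * (j - 1)\<close>.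

  Let \<open>T\<close> have fewer than \<open>r\<close> points, \<open>R - j\<close> of them on the vertices of \<open>H\<close>, and suppose it meets all
  rows. Fix \<open>h\<^sub>0 \<in> H\<close> and label each edge \<open>h\<close> by a point of \<open>h \<inter> h\<^sub>0\<close>; the edges of \<open>H\<close> avoiding \<open>T\<close> carry at
  least \<open>j\<close> of the \<open>R\<close> labels. If \<open>j\<close> is small, join each label to boundedly many columns of both kinds
  such that \<open>j\<close> labels see \<open>2 * j\<close> columns of each kind: one of them is not met by \<open>T\<close>. If \<open>j\<close> is large,
  then \<open>T\<close> misses more columns than the number \<open>v\<close> of its points on \<open>H\<close>; as \<open>v\<close> points meet at most
  \<open>q * v\<close> rows among those rows of \<open>H\<close> that come from loops \<open>(z, z)\<close> of the expander, joining each
  column to boundedly many of these rows in an expanding way suffices. The number of edges thus satisfies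
  \<open>f(r) \<le> C * r + 31 * f(R)\<close> with \<open>62 * R \<le> r\<close>, so it is linear.

  For smaller \<open>n\<close>, substitute such hypergraphs of uniformity about \<open>n / r\<close> into the complete
  \<open>t\<close>-uniform hypergraph on \<open>2 * t - 1\<close> points, where \<open>t\<close> is about \<open>r\<^sup>2 / n\<close>.\<close>

section \<open>Critical hypergraphs\<close>

text \<open>No vertex set is named, and covers range over all finite sets. Only a lower bound on the
  cover number is demanded, because in an intersecting family every edge is itself a cover, of size
  \<open>r\<close>.\<close>

definition crit :: "nat \<Rightarrow> 'a set set \<Rightarrow> bool" where
  "crit r E \<longleftrightarrow> finite E \<and> (\<forall>e\<in>E. finite e \<and> card e = r) \<and> intersecting E \<and>
     (\<forall>T. finite T \<longrightarrow> (\<forall>e\<in>E. T \<inter> e \<noteq> {}) \<longrightarrow> r \<le> card T)"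

lemma critI:
  assumes "finite E" "\<And>e. e \<in> E \<Longrightarrow> finite e" "\<And>e. e \<in> E \<Longrightarrow> card e = r"
    and "\<And>e f. e \<in> E \<Longrightarrow> f \<in> E \<Longrightarrow> e \<inter> f \<noteq> {}"
    and "\<And>T. finite T \<Longrightarrow> card T < r \<Longrightarrow> \<exists>e\<in>E. T \<inter> e = {}"
  shows "crit r E"
  unfolding crit_def intersecting_def using assms by (meson not_le)

lemma crit_missed:
  assumes "crit r E" "finite T" "card T < r"
  obtains e where "e \<in> E" "T \<inter> e = {}"
  using assms unfolding crit_def by (meson not_le)

lemma crit_uniform: "crit r E \<Longrightarrow> e \<in> E \<Longrightarrow> finite e \<and> card e = r"
  by (simp add: crit_def)

lemma crit_meet: "crit r E \<Longrightarrow> e \<in> E \<Longrightarrow> f \<in> E \<Longrightarrow> e \<inter> f \<noteq> {}"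
  by (simp add: crit_def intersecting_def)

lemma crit_finite: "crit r E \<Longrightarrow> finite E" "crit r E \<Longrightarrow> finite (\<Union>E)"
  by (auto simp: crit_def)

lemma crit_card_Union:
  assumes "crit r E" shows "card (\<Union>E) \<le> r * card E"
proof -
  have "card (\<Union>E) \<le> sum card E"
    by (rule card_Union_le_sum_card)
  also have "\<dots> = r * card E" using assms by (simp add: crit_def)
  finally show ?thesis .
qed

lemma crit_image:
  assumes c: "crit r E" and f: "inj_on f (\<Union>E)"
  shows "crit r ((`) f ` E)"
proof (rule critI)
  show "finite ((`) f ` E)" using c by (simp add: crit_def)
  show "finite e'" if "e' \<in> (`) f ` E" for e' using that c by (auto simp: crit_def)
  show "card e' = r" if e': "e' \<in> (`) f ` E" for e'
  proof -
    obtain e where e: "e \<in> E" "e' = f ` e" using e' by auto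
    have "inj_on f e" using f e(1) by (meson Union_upper inj_on_subset)
    then show ?thesis using e c by (simp add: card_image crit_def)
  qed
  show "e' \<inter> f' \<noteq> {}" if ef: "e' \<in> (`) f ` E" "f' \<in> (`) f ` E" for e' f'
  proof -
    obtain e d where "e \<in> E" "d \<in> E" "e' = f ` e" "f' = f ` d" using ef by auto
    moreover then obtain x where "x \<in> e" "x \<in> d" using crit_meet[OF c] by blast
    ultimately show ?thesis by auto
  qed
  show "\<exists>e'\<in>(`) f ` E. T \<inter> e' = {}" if T: "finite T" "card T < r" for T
  proof -
    let ?S = "{x \<in> \<Union>E. f x \<in> T}"
    have "card ?S = card (f ` ?S)"
      using f by (intro card_image[symmetric]) (auto simp: inj_on_def)
    also have "\<dots> \<le> card T" using T by (intro card_mono) auto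
    finally have "card ?S < r" using T by simp
    moreover have "finite ?S" by (rule finite_subset[OF _ crit_finite(2)[OF c]]) auto
    ultimately obtain e where "e \<in> E" "?S \<inter> e = {}" using crit_missed[OF c] by metis
    then show ?thesis by blast
  qed
qed

lemma crit_transfer:
  fixes E :: "'a set set"
  assumes c: "crit r E" and n: "card (\<Union>E) \<le> n"
  obtains E' :: "nat set set" where "crit r E'" "card E' \<le> card E" "\<Union>E' \<subseteq> {..<n}"
proof -
  obtain f where f: "f ` \<Union>E \<subseteq> {..<n}" "inj_on f (\<Union>E)"
    using card_le_inj[of "\<Union>E" "{..<n}"] crit_finite[OF c] n by auto
  have "card ((`) f ` E) \<le> card E" using crit_finite[OF c] by (intro card_image_le)
  then show ?thesis using that[OF crit_image[OF c f(2)]] f(1) by blast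
qed

lemma crit_imp_critical:
  assumes c: "crit r E" and r: "r > 0" and V: "finite V" "\<Union>E \<subseteq> V"
  shows "critical r V E"
proof -
  obtain e where e: "e \<in> E" using crit_missed[OF c, of "{}"] r by auto
  have "cover_number V E = r" unfolding cover_number_def
  proof (rule Least_equality)
    show "\<exists>T. vertex_cover V E T \<and> card T = r"
      using e V c unfolding vertex_cover_def crit_def intersecting_def
      by (intro exI[of _ e]) auto
    show "r \<le> k" if "\<exists>T. vertex_cover V E T \<and> card T = k" for k
      using that V c unfolding vertex_cover_def crit_def by (meson finite_subset)
  qed
  then show ?thesis using c V
    unfolding critical_def hypergraph_def uniform_def crit_def by auto
qed

section \<open>Complete hypergraphs, substitution and extension\<close>

lemma obtain_subset_avoiding:
  assumes "finite A" "finite T" "card T + k \<le> card A"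
  obtains S where "S \<subseteq> A" "card S = k" "T \<inter> S = {}"
proof -
  have "k \<le> card (A - T)"
    using diff_card_le_card_Diff[OF assms(2), of A] assms(3) by simp
  then obtain S where "S \<subseteq> A - T" "card S = k" by (meson obtain_subset_with_card_n)
  then show ?thesis using that by blast
qed

lemma subsets_meet:
  assumes "S \<subseteq> A" "S' \<subseteq> A" "finite A" "card A < card S + card S'"
  shows "S \<inter> S' \<noteq> {}"
proof
  assume "S \<inter> S' = {}"
  then have "card S + card S' = card (S \<union> S')"
    using assms by (metis card_Un_disjoint finite_subset)
  also have "\<dots> \<le> card A" using assms by (intro card_mono) auto
  finally show False using assms by simp
qed

lemma crit_complete:
  assumes "r > 0"
  shows "crit r {e. e \<subseteq> {..<2*r-1} \<and> card e = r}"
proof (rule critI)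
  show "finite {e. e \<subseteq> {..<2*r-1} \<and> card e = r}" by simp
  show "\<exists>e\<in>{e. e \<subseteq> {..<2*r-1} \<and> card e = r}. T \<inter> e = {}" if T: "finite T" "card T < r" for T
  proof -
    have "card T + r \<le> card {..<2*r-1}" using T assms by simp
    then obtain S where "S \<subseteq> {..<2*r-1}" "card S = r" "T \<inter> S = {}"
      by (rule obtain_subset_avoiding[OF finite_lessThan T(1)])
    then show ?thesis by blast
  qed
  show "e \<inter> f \<noteq> {}" if "e \<in> {e. e \<subseteq> {..<2*r-1} \<and> card e = r}"
    "f \<in> {e. e \<subseteq> {..<2*r-1} \<and> card e = r}" for e f
    by (rule subsets_meet[of _ "{..<2*r-1}"]) (use that assms in auto)
qed (auto dest: finite_subset)

lemma binomial_le_four_power: "(2*r - 1) choose r \<le> 4 ^ r"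
proof -
  have "(2*r - 1) choose r \<le> 2 ^ (2*r-1)" by (rule binomial_le_pow2)
  also have "\<dots> \<le> 2 ^ (2*r)" by (intro power_increasing) auto
  finally show ?thesis by (simp add: power_mult)
qed

lemma card_complete_le:
  "card {e. e \<subseteq> {..<2*r-1} \<and> card e = r} \<le> 4 ^ r"
  using n_subsets[of "{..<2*r-1}" r] binomial_le_four_power[of r] by simp

text \<open>Each point of the complete \<open>t\<close>-uniform hypergraph is replaced by its own
  copy of \<open>G\<close>. Two index sets share an index, and inside that copy the two chosen edges
  of \<open>G\<close> meet.\<close>

lemma crit_complete_composition:
  fixes G :: "'a set set"
  assumes G: "crit m G" and t: "t > 0"
  defines "E \<equiv> (\<lambda>(S, \<phi>). Sigma S \<phi>) `
    (SIGMA S:{S. S \<subseteq> {..<2*t-1} \<and> card S = t}. PiE S (\<lambda>_. G))"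
  shows "crit (t * m) E" "card E \<le> 4 ^ t * card G ^ t" "\<Union>E \<subseteq> {..<2*t-1} \<times> \<Union>G"
proof -
  let ?I = "{..<2*t-1}"
  have memE: "e \<in> E \<longleftrightarrow> (\<exists>S \<phi>. S \<subseteq> ?I \<and> card S = t \<and> \<phi> \<in> PiE S (\<lambda>_. G) \<and> e = Sigma S \<phi>)" for e
    unfolding E_def image_iff by (simp add: Bex_def split_paired_Ex)
  have finG: "finite G" using crit_finite[OF G] by simp
  have finS: "finite S" if "S \<subseteq> ?I" for S :: "nat set"
    using finite_subset[OF that] by simp
  have finA: "finite (SIGMA S:{S. S \<subseteq> ?I \<and> card S = t}. PiE S (\<lambda>_. G))"
    by (intro finite_SigmaI finite_PiE) (use finS finG in simp_all)
  show "crit (t * m) E"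
  proof (rule critI)
    show "finite E" unfolding E_def by (rule finite_imageI[OF finA])
  next
    fix e assume "e \<in> E"
    then obtain S \<phi> where e: "S \<subseteq> ?I" "card S = t" "\<phi> \<in> PiE S (\<lambda>_. G)" "e = Sigma S \<phi>"
      unfolding memE by blast
    have fS: "finite S" using finS[OF e(1)] .
    have u: "finite (\<phi> i) \<and> card (\<phi> i) = m" if "i \<in> S" for i
      using crit_uniform[OF G PiE_mem[OF e(3) that]] .
    show "finite e" unfolding e(4) using fS u by (intro finite_SigmaI) auto
    show "card e = t * m" unfolding e(4) using fS u e(2) by simp
  next
    fix e e' assume "e \<in> E" "e' \<in> E"
    from this[unfolded memE] obtain S \<phi> S' \<phi>' where e: "S \<subseteq> ?I" "card S = t" "\<phi> \<in> PiE S (\<lambda>_. G)" "e = Sigma S \<phi>"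
      "S' \<subseteq> ?I" "card S' = t" "\<phi>' \<in> PiE S' (\<lambda>_. G)" "e' = Sigma S' \<phi>'"
      by blast
    have "S \<inter> S' \<noteq> {}" by (rule subsets_meet[of _ ?I]) (use e(1,2,5,6) t in simp_all)
    then obtain i where i: "i \<in> S" "i \<in> S'" by blast
    then have "\<phi> i \<inter> \<phi>' i \<noteq> {}" using crit_meet[OF G PiE_mem[OF e(3)] PiE_mem[OF e(7)]] by blast
    then obtain x where "x \<in> \<phi> i" "x \<in> \<phi>' i" by blast
    then have "(i, x) \<in> e \<inter> e'" unfolding e(4,8) using i by simp
    then show "e \<inter> e' \<noteq> {}" by blast
  next
    fix T :: "(nat \<times> 'a) set" assume T: "finite T" "card T < t * m"
    define X where "X i = {x. (i, x) \<in> T}" for i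
    have finX: "finite (X i)" for i
    proof -
      have "X i \<subseteq> snd ` T" unfolding X_def by (auto intro: rev_image_eqI)
      then show ?thesis using T finite_subset by blast
    qed
    \<comment> \<open>Copies in which \<open>T\<close> meets every edge cost \<open>m\<close> points
      each, so there are fewer than \<open>t\<close> of them. At least \<open>t\<close> of the
      \<open>2*t-1\<close> copies remain, each with an edge that \<open>T\<close> misses.\<close>
    define B where "B = {i \<in> ?I. \<forall>g\<in>G. X i \<inter> g \<noteq> {}}"
    have "card B * m = (\<Sum>i\<in>B. m)" by simp
    also have "\<dots> \<le> (\<Sum>i\<in>B. card (X i))"
      by (intro sum_mono) (use G finX in \<open>auto simp: B_def crit_def\<close>)
    also have "\<dots> = card (Sigma B X)" using finX by (simp add: B_def)
    also have "\<dots> \<le> card T" by (rule card_mono) (auto simp: X_def T)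
    finally have "card B < t" using T by (metis le_less_trans mult_less_cancel2)
    then have "card B + t \<le> card ?I" by simp
    moreover have "finite B" by (simp add: B_def)
    ultimately obtain S where S: "S \<subseteq> ?I" "card S = t" "B \<inter> S = {}"
      using obtain_subset_avoiding[OF finite_lessThan] by metis
    have "\<forall>i\<in>S. \<exists>g\<in>G. X i \<inter> g = {}" using S unfolding B_def by blast
    then obtain \<phi> where \<phi>: "\<forall>i\<in>S. \<phi> i \<in> G \<and> X i \<inter> \<phi> i = {}" by metis
    have "restrict \<phi> S \<in> PiE S (\<lambda>_. G)" using \<phi> by simp
    then have "Sigma S (restrict \<phi> S) \<in> E" unfolding memE using S by blast
    moreover have "T \<inter> Sigma S (restrict \<phi> S) = {}" using \<phi> unfolding X_def by force
    ultimately show "\<exists>e\<in>E. T \<inter> e = {}" by blast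
  qed
  have "card E \<le> card (SIGMA S:{S. S \<subseteq> ?I \<and> card S = t}. PiE S (\<lambda>_. G))"
    unfolding E_def by (rule card_image_le[OF finA])
  also have "\<dots> = (\<Sum>S\<in>{S. S \<subseteq> ?I \<and> card S = t}. card (PiE S (\<lambda>_. G)))"
    by (rule card_SigmaI) (use finS finG in \<open>auto intro!: finite_PiE\<close>)
  also have "\<dots> = (\<Sum>S\<in>{S. S \<subseteq> ?I \<and> card S = t}. card G ^ t)"
    by (intro sum.cong refl) (use finS in \<open>simp add: card_PiE\<close>)
  also have "\<dots> \<le> 4 ^ t * card G ^ t" using card_complete_le[of t] by simp
  finally show "card E \<le> 4 ^ t * card G ^ t" .
  show "\<Union>E \<subseteq> ?I \<times> \<Union>G"
  proof
    fix p assume "p \<in> \<Union>E"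
    then obtain S \<phi> where e: "S \<subseteq> ?I" "\<phi> \<in> PiE S (\<lambda>_. G)" "p \<in> Sigma S \<phi>"
      unfolding Union_iff Bex_def memE by blast
    then show "p \<in> ?I \<times> \<Union>G" by (auto dest: PiE_mem)
  qed
qed

text \<open>Raises the uniformity by an arbitrary \<open>p\<close>; this handles the remainder when
  \<open>t\<close> does not divide \<open>r\<close>. The size of \<open>Y\<close> is the largest for
  which every \<open>p\<close>-subset meets every \<open>(a + p)\<close>-subset.\<close>

lemma crit_extension:
  fixes G :: "'a set set"
  assumes G: "crit a G" and p: "p > 0"
  defines "Y \<equiv> {..<a + 2*p - 1}"
  defines "E \<equiv> (\<lambda>(g, S). Inl ` g \<union> Inr ` S) ` (G \<times> {S. S \<subseteq> Y \<and> card S = p})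
     \<union> (`) Inr ` {F. F \<subseteq> Y \<and> card F = a + p}"
  shows "crit (a + p) E" "card E \<le> (card G + 1) * (((a + 2*p - 1) choose p) + ((a + 2*p - 1) choose (a + p)))"
    "\<Union>E \<subseteq> \<Union>G <+> Y"
proof -
  let ?A = "{S. S \<subseteq> Y \<and> card S = p}" and ?B = "{F. F \<subseteq> Y \<and> card F = a + p}"
  have fY: "finite Y" "card Y = a + 2*p - 1" by (auto simp: Y_def)
  have fin: "finite ?A" "finite ?B" "finite G" using fY crit_finite[OF G] by auto
  have cases: "(\<exists>g S. g \<in> G \<and> S \<subseteq> Y \<and> card S = p \<and> e = Inl ` g \<union> Inr ` S) \<or>
      (\<exists>F. F \<subseteq> Y \<and> card F = a + p \<and> e = Inr ` F)" if "e \<in> E" for e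
    using that unfolding E_def by (elim UnE imageE) auto
  have u: "finite g \<and> card g = a" if "g \<in> G" for g using crit_uniform[OF G that] .
  have mix: "Inl ` g \<union> Inr ` S \<in> E" if "g \<in> G" "S \<subseteq> Y" "card S = p" for g S
    unfolding E_def by (rule UnI1, rule image_eqI[where x = "(g, S)"]) (use that in auto)
  have only: "Inr ` F \<in> E" if "F \<subseteq> Y" "card F = a + p" for F
    unfolding E_def by (rule UnI2, rule imageI) (use that in simp)
  show "crit (a + p) E"
  proof (rule critI)
    show "finite E" unfolding E_def using fin by simp
    show "finite e" if "e \<in> E" for e
      using cases[OF that]
    proof (elim disjE exE conjE)
      fix g S assume *: "g \<in> G" "S \<subseteq> Y" "e = Inl ` g \<union> Inr ` S"
      then have "finite g" "finite S" using u fY finite_subset by auto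
      then show ?thesis using * by simp
    next
      fix F assume *: "F \<subseteq> Y" "e = Inr ` F"
      then have "finite F" using fY finite_subset by auto
      then show ?thesis using * by simp
    qed
    show "card e = a + p" if "e \<in> E" for e
      using cases[OF that]
    proof (elim disjE exE conjE)
      fix g S assume *: "g \<in> G" "S \<subseteq> Y" "card S = p" "e = Inl ` g \<union> Inr ` S"
      then have "finite g" "finite S" "card g = a" using u fY finite_subset by auto
      then have "card (g <+> S) = a + p" using * by (simp add: card_Plus)
      then show ?thesis using * by (simp add: Plus_def)
    next
      fix F assume *: "card F = a + p" "e = (Inr ` F :: ('a + nat) set)"
      then show ?thesis by (simp add: card_image)
    qed
    show "e \<inter> f \<noteq> {}" if ef: "e \<in> E" "f \<in> E" for e f
    proof -
      have m1: "\<exists>y. y \<in> S \<and> y \<in> F" if "S \<subseteq> Y" "card S = p" "F \<subseteq> Y" "card F = a + p" for S F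
        using subsets_meet[OF that(1,3) fY(1)] that(2,4) fY(2) p by fastforce
      have m2: "\<exists>y. y \<in> F' \<and> y \<in> F" if "F' \<subseteq> Y" "card F' = a + p" "F \<subseteq> Y" "card F = a + p" for F' F
        using subsets_meet[OF that(1,3) fY(1)] that(2,4) fY(2) p by fastforce
      from cases[OF ef(1)] show ?thesis
      proof (elim disjE exE conjE)
        fix g S assume 1: "g \<in> G" "S \<subseteq> Y" "card S = p" "e = Inl ` g \<union> Inr ` S"
        from cases[OF ef(2)] show ?thesis
        proof (elim disjE exE conjE)
          fix g' S' assume 2: "g' \<in> G" "f = Inl ` g' \<union> Inr ` S'"
          obtain x where "x \<in> g" "x \<in> g'" using crit_meet[OF G] 1 2 by blast
          then have "Inl x \<in> e \<inter> f" using 1 2 by simp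
          then show ?thesis by blast
        next
          fix F assume 2: "F \<subseteq> Y" "card F = a + p" "f = Inr ` F"
          obtain y where "y \<in> S" "y \<in> F" using m1 1 2 by blast
          then have "Inr y \<in> e \<inter> f" using 1 2 by simp
          then show ?thesis by blast
        qed
      next
        fix F assume 1: "F \<subseteq> Y" "card F = a + p" "e = Inr ` F"
        from cases[OF ef(2)] show ?thesis
        proof (elim disjE exE conjE)
          fix g S assume 2: "S \<subseteq> Y" "card S = p" "f = Inl ` g \<union> Inr ` S"
          obtain y where "y \<in> S" "y \<in> F" using m1 1 2 by blast
          then have "Inr y \<in> e \<inter> f" using 1 2 by simp
          then show ?thesis by blast
        next
          fix F' assume 2: "F' \<subseteq> Y" "card F' = a + p" "f = Inr ` F'"
          obtain y where "y \<in> F" "y \<in> F'" using m2 1 2 by blast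
          then have "Inr y \<in> e \<inter> f" using 1 2 by simp
          then show ?thesis by blast
        qed
      qed
    qed
    fix T :: "('a + nat) set" assume T: "finite T" "card T < a + p"
    define T1 where "T1 = Inl -` T" define T2 where "T2 = Inr -` T"
    have f12: "finite T1" "finite T2" using T unfolding T1_def T2_def
      by (auto intro: finite_vimageI)
    have "x \<in> T \<longleftrightarrow> x \<in> T1 <+> T2" for x by (cases x) (auto simp: T1_def T2_def)
    then have "T = T1 <+> T2" by blast
    then have c12: "card T1 + card T2 < a + p" using T f12 by (simp add: card_Plus)
    show "\<exists>e\<in>E. T \<inter> e = {}"
    proof (cases "card T1 < a \<and> card T2 < a + p")
      case True
      then obtain g where g: "g \<in> G" "T1 \<inter> g = {}" using crit_missed[OF G] f12 by metis
      obtain S where S: "S \<subseteq> Y" "card S = p" "T2 \<inter> S = {}"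
        by (rule obtain_subset_avoiding[OF fY(1) f12(2), of p]) (use True fY(2) p in linarith)
      have "T \<inter> (Inl ` g \<union> Inr ` S) = {}" using g S unfolding T1_def T2_def by auto
      then show ?thesis using mix g S by blast
    next
      \<comment> \<open>\<open>T2\<close> always has fewer than \<open>a + p\<close> points, so here
        \<open>T1\<close> has at least \<open>a\<close>, which leaves fewer than \<open>p\<close>
        for \<open>T2\<close>.\<close>
      case False
      then have T2p: "card T2 < p" using c12 by auto
      obtain F where F: "F \<subseteq> Y" "card F = a + p" "T2 \<inter> F = {}"
        by (rule obtain_subset_avoiding[OF fY(1) f12(2), of "a + p"]) (use T2p fY(2) in simp)
      have "T \<inter> Inr ` F = {}" using F unfolding T2_def by auto
      then show ?thesis using only F by blast
    qed
  qed
  have "card E \<le> card (G \<times> ?A) + card ?B" unfolding E_def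
    by (intro card_Un_le[THEN order_trans] add_mono card_image_le) (use fin in auto)
  also have "\<dots> = card G * ((a + 2*p - 1) choose p) + ((a + 2*p - 1) choose (a + p))"
    using n_subsets[OF fY(1)] fY(2) by (simp add: card_cartesian_product)
  also have "\<dots> \<le> (card G + 1) * (((a + 2*p - 1) choose p) + ((a + 2*p - 1) choose (a + p)))"
    by (simp add: algebra_simps)
  finally show "card E \<le> (card G + 1) * (((a + 2*p - 1) choose p) + ((a + 2*p - 1) choose (a + p)))" .
  show "\<Union>E \<subseteq> \<Union>G <+> Y" unfolding E_def by (auto simp: Plus_def)
qed

section \<open>Expanders\<close>

text \<open>\<open>a ^ a / fact a\<close> is a single term of the series of \<open>exp a\<close>,
  and \<open>exp 1\<close> is at most 3.\<close>

lemma self_power_le_fact: "real a ^ a \<le> 3 ^ a * fact a"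
proof -
  have "real a ^ a / fact a \<le> (\<Sum>k<Suc a. real a ^ k / fact k)"
    by (rule member_le_sum[where f = "\<lambda>k. real a ^ k / fact k"]) auto
  also have "\<dots> \<le> (\<Sum>k. real a ^ k / fact k)"
    by (rule sum_le_suminf) (use summable_exp_generic[of "real a"] in \<open>auto simp: divide_inverse mult.commute scaleR_conv_of_real\<close>)
  also have "\<dots> = exp (real a)"
    by (simp add: exp_def divide_inverse mult.commute)
  also have "\<dots> = exp 1 ^ a" by (simp add: exp_of_nat_mult[symmetric])
  also have "\<dots> \<le> 3 ^ a" using exp_le by (intro power_mono) auto
  finally show ?thesis by (simp add: divide_simps mult.commute)
qed

lemma binomial_le_power_div: "a > 0 \<Longrightarrow> real (n choose a) \<le> (3 * real n / real a) ^ a"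
proof -
  assume a: "a > 0"
  have *: "real (n choose a) * fact a \<le> real n ^ a"
    by (metis binomial_fact_pow of_nat_fact of_nat_le_iff of_nat_mult of_nat_power)
  have "real (n choose a) * real a ^ a \<le> real (n choose a) * (3 ^ a * fact a)"
    using self_power_le_fact[of a] by (intro mult_left_mono) auto
  also have "\<dots> = (real (n choose a) * fact a) * 3 ^ a" by (simp only: mult_ac)
  also have "\<dots> \<le> real n ^ a * 3 ^ a" using * by (rule mult_right_mono) simp
  finally have "real (n choose a) * real a ^ a \<le> (3 * real n) ^ a"
    by (simp add: power_mult_distrib mult.commute)
  then show ?thesis using a by (simp add: power_divide pos_le_divide_eq)
qed

lemma sum_powers_quarter_lt_one: "(\<Sum>a\<in>{1..m::nat}. (1/4::real) ^ a) < 1"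
proof -
  have "(\<Sum>a\<in>{1..m}. (1/4::real) ^ a) = 1/3 - (1/3) * (1/4) ^ m"
    by (induction m) simp_all
  also have "\<dots> < 1"
    using zero_le_power[of "1/4::real" m] by linarith
  finally show ?thesis .
qed

text \<open>One summand of the union bound: the choices of an \<open>a\<close>-set and of a
  \<open>2 * a\<close>-set, times the probability that \<open>28 * a\<close> uniform values all land
  in the latter. With \<open>x = a / n\<close>, three of the 28 factors \<open>2 * x\<close> cancel
  against the binomials, the other 25 are at most \<open>4/5\<close>, and
  \<open>54 * (4/5) ^ 25\<close> is below \<open>1/4\<close>.\<close>

lemma bad_count_bound:
  assumes a: "a > 0" "5 * a \<le> 2 * n"
  shows "real (n choose a) * real (n choose (2*a)) * (2 * real a / real n) ^ (28 * a) \<le> (1/4) ^ a"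
proof -
  have n: "n > 0" using a by simp
  define x where "x = real a / real n"
  have "x ^ 28 = x * (x * (x * x ^ 25))" by (simp add: eval_nat_numeral)
  have x: "x > 0" "x \<le> 2/5" using a n by (auto simp: x_def divide_simps)
  have "real (n choose a) \<le> (3 / x) ^ a"
    using binomial_le_power_div[of a n] a by (simp add: x_def)
  moreover have "real (n choose (2*a)) \<le> (3 / (2*x)) ^ (2 * a)"
    using binomial_le_power_div[of "2*a" n] a by (simp add: x_def)
  ultimately have "real (n choose a) * real (n choose (2*a)) \<le> (3 / x) ^ a * (3 / (2*x)) ^ (2 * a)"
    using x by (intro mult_mono) auto
  then have "real (n choose a) * real (n choose (2*a)) * (2 * x) ^ (28 * a) \<le>
      (3 / x) ^ a * (3 / (2*x)) ^ (2 * a) * (2 * x) ^ (28 * a)"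
    using x by (intro mult_right_mono) auto
  also have "\<dots> = ((3 / x) * (3 / (2*x)) ^ 2 * (2 * x) ^ 28) ^ a"
    by (simp only: power_mult power_mult_distrib)
  also have "(3 / x) * (3 / (2*x)) ^ 2 * (2 * x) ^ 28 = 54 * (2 * x) ^ 25"
    using x \<open>x ^ 28 = x * (x * (x * x ^ 25))\<close> by (simp add: field_simps power2_eq_square)
  also have "(54 * (2 * x) ^ 25) ^ a \<le> (54 * (4/5) ^ 25) ^ a"
    using x by (intro power_mono mult_left_mono) auto
  also have "\<dots> \<le> (1/4) ^ a" by (intro power_mono) (auto simp: eval_nat_numeral)
  finally show ?thesis by (simp add: x_def)
qed

lemma card_maps_into:
  assumes "finite P" "Q \<subseteq> P" "finite Y" "B \<subseteq> Y"
  shows "card {f \<in> PiE P (\<lambda>_. Y). f ` Q \<subseteq> B} = card B ^ card Q * card Y ^ (card P - card Q)"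
proof -
  have "{f \<in> PiE P (\<lambda>_. Y). f ` Q \<subseteq> B} = PiE P (\<lambda>p. if p \<in> Q then B else Y)"
  proof (intro equalityI subsetI)
    fix f assume "f \<in> {f \<in> PiE P (\<lambda>_. Y). f ` Q \<subseteq> B}"
    then have "f \<in> PiE P (\<lambda>_. Y)" "f ` Q \<subseteq> B" by auto
    then show "f \<in> PiE P (\<lambda>p. if p \<in> Q then B else Y)" unfolding PiE_iff by auto
  next
    fix f assume f: "f \<in> PiE P (\<lambda>p. if p \<in> Q then B else Y)"
    have "f p \<in> Y" if "p \<in> P" for p using PiE_mem[OF f that] assms(4) by (auto split: if_splits)
    moreover have "f p \<in> B" if "p \<in> Q" for p using PiE_mem[OF f, of p] assms(2) that by auto
    ultimately show "f \<in> {f \<in> PiE P (\<lambda>_. Y). f ` Q \<subseteq> B}" using f unfolding PiE_iff by auto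
  qed
  then have "card {f \<in> PiE P (\<lambda>_. Y). f ` Q \<subseteq> B} = (\<Prod>p\<in>P. if p \<in> Q then card B else card Y)"
    using assms by (simp add: card_PiE if_distrib)
  also have "\<dots> = (\<Prod>p\<in>Q. card B) * (\<Prod>p\<in>P - Q. card Y)"
    using assms by (subst prod.subset_diff[of Q P]) (auto simp: mult.commute)
  also have "\<dots> = card B ^ card Q * card Y ^ (card P - card Q)"
    using assms by (simp add: card_Diff_subset finite_subset)
  finally show ?thesis .
qed


text \<open>The degree 29 is 28 random images plus \<open>z\<close> itself; having \<open>z\<close>
  in \<open>F z\<close> makes the pairs \<open>(z, z)\<close> available as rows later. A set of
  \<open>2 * n / 5\<close> points already reaches about \<open>4 * n / 5\<close>, so whatever is
  separated from it falls below the threshold.\<close>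

definition doubling :: "nat \<Rightarrow> (nat \<Rightarrow> nat set) \<Rightarrow> bool" where
  "doubling n F \<longleftrightarrow> (\<forall>z<n. z \<in> F z \<and> F z \<subseteq> {..<n} \<and> card (F z) \<le> 29) \<and>
     (\<forall>A\<subseteq>{..<n}. 5 * card A \<le> 2 * n \<longrightarrow> 2 * card A \<le> card (\<Union>z\<in>A. F z))"

text \<open>Random maps expand: count the \<open>w\<close>-tuples of maps of \<open>{..<n}\<close> to itself that send some
  \<open>a\<close>-set into a \<open>2a\<close>-set.\<close>

lemma doubling_exists: obtains F where "doubling n F"
proof -
  define Y P W where "Y = {..<n}" and "P = {..<n} \<times> {..<28::nat}" and "W = {..<28::nat}"
  define bad where "bad A B = {f \<in> PiE P (\<lambda>_. Y). f ` (A \<times> W) \<subseteq> B}" for A B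
  define sub where "sub a = {A. A \<subseteq> Y \<and> card A = a}" for a
  define I where "I = {1..2 * n div 5}"
  have fin: "finite Y" "finite P" "card Y = n" "card P = n * 28" by (auto simp: Y_def P_def)
  have fsub: "finite (sub a)" "card (sub a) = n choose a" for a
    using n_subsets[OF fin(1)] fin by (auto simp: sub_def)
  have cbad: "real (card (bad A B)) = (2 * real a / real n) ^ (28 * a) * real n ^ (n * 28)"
    if "a \<in> I" "A \<in> sub a" "B \<in> sub (2 * a)" for a A B
  proof -
    have a: "5 * a \<le> 2 * n" "a > 0" using that by (auto simp: I_def)
    have AB: "A \<subseteq> Y" "card A = a" "B \<subseteq> Y" "card B = 2 * a" using that by (auto simp: sub_def)
    have "A \<times> W \<subseteq> P" using AB by (auto simp: P_def W_def Y_def)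
    then have "card (bad A B) = card B ^ card (A \<times> W) * card Y ^ (card P - card (A \<times> W))"
      unfolding bad_def using fin AB by (intro card_maps_into)
    then have "real (card (bad A B)) = (2 * real a) ^ (28 * a) * real n ^ (n * 28 - 28 * a)"
      using AB fin by (simp add: card_cartesian_product W_def mult.commute)
    moreover have "real n ^ (n * 28) = real n ^ (n * 28 - 28 * a) * real n ^ (28 * a)"
      using a by (simp flip: power_add)
    moreover have "real n > 0" using a by simp
    ultimately show ?thesis by (simp add: power_divide)
  qed
  have "\<exists>f \<in> PiE P (\<lambda>_. Y). \<forall>a\<in>I. \<forall>A\<in>sub a. \<forall>B\<in>sub (2 * a). f \<notin> bad A B"
  proof (rule ccontr)
    assume neg: "\<not> ?thesis"
    have "PiE P (\<lambda>_. Y) \<subseteq> (\<Union>a\<in>I. \<Union>A\<in>sub a. \<Union>B\<in>sub (2 * a). bad A B)"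
      using neg by blast
    moreover have "finite (\<Union>a\<in>I. \<Union>A\<in>sub a. \<Union>B\<in>sub (2 * a). bad A B)"
      unfolding bad_def using fin fsub by (auto simp: I_def intro!: finite_PiE)
    ultimately have "card (PiE P (\<lambda>_. Y)) \<le> card (\<Union>a\<in>I. \<Union>A\<in>sub a. \<Union>B\<in>sub (2 * a). bad A B)"
      by (rule card_mono[rotated])
    also have "\<dots> \<le> (\<Sum>a\<in>I. card (\<Union>A\<in>sub a. \<Union>B\<in>sub (2 * a). bad A B))"
      by (rule card_UN_le) (simp add: I_def)
    also have "\<dots> \<le> (\<Sum>a\<in>I. \<Sum>A\<in>sub a. \<Sum>B\<in>sub (2 * a). card (bad A B))"
      by (intro sum_mono order_trans[OF card_UN_le] fsub order_refl)
    finally have "real (card (PiE P (\<lambda>_. Y))) \<le>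
        (\<Sum>a\<in>I. \<Sum>A\<in>sub a. \<Sum>B\<in>sub (2 * a). real (card (bad A B)))"
      by (simp flip: of_nat_sum)
    also have "\<dots> = (\<Sum>a\<in>I. (real (n choose a) * real (n choose (2*a)) *
        (2 * real a / real n) ^ (28 * a)) * real n ^ (n * 28))"
      by (intro sum.cong refl) (simp add: cbad fsub)
    also have "\<dots> \<le> (\<Sum>a\<in>I. (1/4) ^ a * real n ^ (n * 28))"
      by (intro sum_mono mult_right_mono bad_count_bound) (auto simp: I_def)
    also have "\<dots> = (\<Sum>a\<in>I. (1/4) ^ a) * real n ^ (n * 28)"
      by (simp add: sum_distrib_right)
    finally have *: "real n ^ (n * 28) \<le> (\<Sum>a\<in>I. (1/4) ^ a) * real n ^ (n * 28)"
      using fin by (simp add: card_PiE)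
    have "real n ^ (n * 28) > 0" by (cases "n = 0") auto
    then show False
      using * sum_powers_quarter_lt_one[of "2 * n div 5"] by (simp add: I_def)
  qed
  then obtain f where f: "f \<in> PiE P (\<lambda>_. Y)"
    and good: "\<And>a A B. a \<in> I \<Longrightarrow> A \<in> sub a \<Longrightarrow> B \<in> sub (2 * a) \<Longrightarrow> f \<notin> bad A B" by blast
  define F where "F z = insert z ((\<lambda>l. f (z, l)) ` W)" for z
  have FY: "F z \<subseteq> Y" if "z < n" for z
    using that f by (auto simp: F_def W_def P_def Y_def dest: PiE_mem)
  have member: "z \<in> F z \<and> F z \<subseteq> {..<n} \<and> card (F z) \<le> 29" if "z < n" for z
  proof -
    have "card (F z) \<le> Suc (card ((\<lambda>l. f (z, l)) ` W))" unfolding F_def by (simp add: card_insert_if W_def)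
    also have "\<dots> \<le> Suc (card W)" using card_image_le[of W] by (simp add: W_def)
    finally show ?thesis using FY[OF that] by (simp add: F_def W_def Y_def)
  qed
  have expands: "2 * card A \<le> card (\<Union>z\<in>A. F z)" if A: "A \<subseteq> {..<n}" "5 * card A \<le> 2 * n" for A
  proof (rule ccontr)
    assume neg: "\<not> ?thesis"
    have "(\<Union>z\<in>A. F z) \<subseteq> Y" using FY A by auto
    moreover have "2 * card A \<le> card Y" using A fin by simp
    ultimately obtain B where B: "(\<Union>z\<in>A. F z) \<subseteq> B" "B \<subseteq> Y" "card B = 2 * card A"
      using exists_subset_between[of "\<Union>z\<in>A. F z" "2 * card A" Y] neg fin by auto
    have "card A \<in> I" using A neg by (auto simp: I_def)
    moreover have "A \<in> sub (card A)" "B \<in> sub (2 * card A)" using A B by (auto simp: sub_def Y_def)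
    moreover have "f \<in> bad A B" using f B(1) unfolding bad_def F_def by auto
    ultimately show False using good by blast
  qed
  show thesis using that[of F] member expands by (simp add: doubling_def)
qed

section \<open>Vertex expansion and separated sets\<close>

lemma doubling_subset: "doubling n F \<Longrightarrow> A \<subseteq> {..<n} \<Longrightarrow> (\<Union>z\<in>A. F z) \<subseteq> {..<n}"
  unfolding doubling_def by blast

lemma doubling_expands:
  "doubling n F \<Longrightarrow> A \<subseteq> {..<n} \<Longrightarrow> 5 * card A \<le> 2 * n \<Longrightarrow> 2 * card A \<le> card (\<Union>z\<in>A. F z)"
  unfolding doubling_def by blast

text \<open>Doubling is applied to a subset of \<open>2 * n div 5\<close> points; the 8 pays for
  rounding down.\<close>

lemma doubling_expands_large:
  assumes F: "doubling n F" and A: "A \<subseteq> {..<n}" "2 * n < 5 * card A"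
  shows "4 * n \<le> 5 * card (\<Union>z\<in>A. F z) + 8"
proof -
  obtain A0 where A0: "A0 \<subseteq> A" "card A0 = 2 * n div 5"
    by (rule obtain_subset_with_card_n[of "2 * n div 5" A]) (use A(2) in simp)
  have "2 * card A0 \<le> card (\<Union>z\<in>A0. F z)"
    using A0 A by (intro doubling_expands[OF F]) auto
  also have "\<dots> \<le> card (\<Union>z\<in>A. F z)"
    using A0 doubling_subset[OF F A(1)] by (intro card_mono) (auto dest: finite_subset)
  finally show ?thesis using A0 by linarith
qed

lemma doubling_separation_small:
  assumes F: "doubling n F" and AB: "A \<subseteq> {..<n}" "B \<subseteq> {..<n}"
    and sep: "(\<Union>z\<in>A. F z) \<inter> B = {}" and A: "5 * card A \<le> 2 * n"
  shows "2 * card A + card B \<le> n"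
proof -
  let ?N = "\<Union>z\<in>A. F z"
  have N: "?N \<subseteq> {..<n}" using doubling_subset[OF F AB(1)] .
  have "2 * card A + card B \<le> card ?N + card B"
    using doubling_expands[OF F AB(1) A] by simp
  also have "\<dots> = card (?N \<union> B)"
    using N AB sep by (intro card_Un_disjoint[symmetric]) (auto dest: finite_subset)
  also have "\<dots> \<le> card {..<n}" using N AB by (intro card_mono) auto
  finally show ?thesis by simp
qed

text \<open>If \<open>A\<close> is above the threshold, its neighbourhood leaves at most
  \<open>(n + 8) / 5\<close> points for \<open>B\<close>, which is at most \<open>2 * n / 5\<close>
  as soon as \<open>n \<ge> 8\<close>. So one of the two sets can always be doubled, and separation
  in both directions lets either of them play that role.\<close>

lemma doubling_separation:
  assumes F: "doubling n F" and n: "n \<ge> 8" and AB: "A \<subseteq> {..<n}" "B \<subseteq> {..<n}"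
    and sep: "\<And>z y. z \<in> A \<Longrightarrow> y \<in> B \<Longrightarrow> y \<notin> F z \<and> z \<notin> F y"
  shows "2 * card A + card B \<le> n \<or> card A + 2 * card B \<le> n"
proof (cases "5 * card A \<le> 2 * n")
  case True
  have "(\<Union>z\<in>A. F z) \<inter> B = {}" using sep by blast
  then show ?thesis using doubling_separation_small[OF F AB _ True] by simp
next
  case False
  have sepA: "(\<Union>z\<in>A. F z) \<inter> B = {}" and sepB: "(\<Union>z\<in>B. F z) \<inter> A = {}" using sep by blast+
  have N: "(\<Union>z\<in>A. F z) \<subseteq> {..<n}" using doubling_subset[OF F AB(1)] .
  have "card (\<Union>z\<in>A. F z) + card B = card ((\<Union>z\<in>A. F z) \<union> B)"
    using N AB sepA by (intro card_Un_disjoint[symmetric]) (auto dest: finite_subset)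
  also have "\<dots> \<le> card {..<n}" using N AB by (intro card_mono) auto
  finally have "card (\<Union>z\<in>A. F z) + card B \<le> n" by simp
  moreover have "4 * n \<le> 5 * card (\<Union>z\<in>A. F z) + 8"
    using doubling_expands_large[OF F AB(1)] False by simp
  ultimately have "5 * card B \<le> 2 * n" using n by linarith
  then show ?thesis using doubling_separation_small[OF F AB(2,1) sepB] by simp
qed

section \<open>Iterated neighbourhoods\<close>

primrec spread :: "(nat \<Rightarrow> nat set) \<Rightarrow> nat \<Rightarrow> nat \<Rightarrow> nat set" where
  "spread F 0 z = {z}"
| "spread F (Suc l) z = (\<Union>y\<in>spread F l z. F y)"

lemma spread_subset: "doubling n F \<Longrightarrow> z < n \<Longrightarrow> spread F l z \<subseteq> {..<n}"
  by (induction l) (auto simp: doubling_def)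

lemma card_spread_le:
  assumes "doubling n F" "z < n"
  shows "card (spread F l z) \<le> 29 ^ l"
proof (induction l)
  case (Suc l)
  have s: "spread F l z \<subseteq> {..<n}" by (rule spread_subset[OF assms])
  then have "finite (spread F l z)" by (rule finite_subset) simp
  then have "card (spread F (Suc l) z) \<le> (\<Sum>y\<in>spread F l z. card (F y))"
    by (simp add: card_UN_le)
  also have "\<dots> \<le> (\<Sum>y\<in>spread F l z. 29)"
    using s assms(1) by (intro sum_mono) (auto simp: doubling_def)
  also have "\<dots> \<le> 29 ^ Suc l" using Suc by simp
  finally show ?case .
qed simp

text \<open>Below the threshold each step doubles; above it, the next neighbourhood is at least as
  large as any admissible \<open>k\<close>.\<close>

lemma spread_expands:
  assumes F: "doubling n F" and S: "S \<subseteq> {..<n}"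
    and k: "k \<le> 2 ^ l * card S" "5 * k + 8 \<le> 4 * n"
  shows "k \<le> card (\<Union>z\<in>S. spread F l z)"
  using k
proof (induction l arbitrary: k)
  case (Suc l)
  let ?A = "\<Union>z\<in>S. spread F l z"
  have A: "?A \<subseteq> {..<n}" using spread_subset[OF F] S by blast
  have eq: "(\<Union>z\<in>S. spread F (Suc l) z) = (\<Union>y\<in>?A. F y)" by auto
  show ?case
  proof (cases "5 * card ?A \<le> 2 * n")
    case True
    \<comment> \<open>Half of \<open>k\<close>, rounded up, is what the first \<open>l\<close> steps
      must deliver before the last doubling.\<close>
    have "(k + 1) div 2 \<le> card ?A"
      by (rule Suc.IH; cases "k = 0") (use Suc.prems in auto)
    then show ?thesis using doubling_expands[OF F A True] unfolding eq by linarith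
  next
    case False
    then show ?thesis using doubling_expands_large[OF F A] Suc.prems unfolding eq by linarith
  qed
qed simp

text \<open>Reduction modulo \<open>m\<close> identifies at most \<open>q\<close> indices;
  \<open>q\<close> doubling steps make up for this since \<open>2 ^ q\<close> exceeds
  \<open>q\<close>.\<close>

lemma spread_mod_expands:
  assumes F: "doubling m F" and S: "S \<subseteq> {..<q * m}" "5 * card S + 8 \<le> 4 * m"
  shows "card S \<le> card (\<Union>s\<in>S. spread F q (s mod m))"
proof -
  let ?S = "(\<lambda>s. s mod m) ` S"
  have finS: "finite S" using S finite_subset by blast
  have m: "m > 0" using S by simp
  have "card S = card ((\<lambda>s. (s div m, s mod m)) ` S)"
    by (intro card_image[symmetric]) (metis (mono_tags, lifting) div_mult_mod_eq inj_onI prod.inject)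
  also have "\<dots> \<le> card ({..<q} \<times> ?S)"
    using S finS by (intro card_mono) (auto simp: less_mult_imp_div_less)
  also have "\<dots> = q * card ?S" by (simp add: card_cartesian_product)
  also have "\<dots> \<le> 2 ^ q * card ?S" by (intro mult_right_mono) (auto simp: less_imp_le)
  finally have "card S \<le> card (\<Union>z\<in>?S. spread F q z)"
    using S m by (intro spread_expands[OF F]) auto
  then show ?thesis by simp
qed

section \<open>Partitions covering pairs\<close>

text \<open>The difference of the slopes is invertible modulo \<open>n\<close>, so the linear
  equation for \<open>b\<close> is solvable.\<close>

lemma lines_meet:
  fixes n q :: nat
  assumes n: "n > 0" and cop: "\<And>d. 0 < d \<Longrightarrow> d < q \<Longrightarrow> coprime d n"
    and c: "c < q" "c' < q" "c \<noteq> c'"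
  shows "\<exists>b<n. (z + c * b) mod n = (z' + c' * b) mod n"
proof -
  have *: "\<exists>b<n. (z + c * b) mod n = (z' + c' * b) mod n"
    if "c < c'" "c' < q" for c c' z z' :: nat
  proof -
    define d where "d = c' - c"
    have d: "c' = c + d" "coprime d n" using that cop[of d] by (auto simp: d_def)
    obtain x where x: "[d * x = 1] (mod n)" using cong_solve_coprime_nat[OF d(2)] by auto
    \<comment> \<open>Represents \<open>z - z'\<close> modulo \<open>n\<close> by a natural
      number.\<close>
    define y where "y = z + (n - 1) * z'"
    define b where "b = (x * y) mod n"
    have "[z' + d * b = z' + (d * x) * y] (mod n)"
      unfolding b_def by (simp add: cong_def mod_add_right_eq mod_mult_right_eq mult.assoc)
         (metis mod_add_right_eq mod_mult_right_eq)
    also have "[z' + (d * x) * y = z' + 1 * y] (mod n)"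
      using x by (intro cong_add cong_mult cong_refl)
    also have "z' + 1 * y = z + n * z'" using n by (cases n) (auto simp: y_def)
    also have "[z + n * z' = z] (mod n)" by (simp add: cong_def)
    finally have "[c * b + (z' + d * b) = c * b + z] (mod n)"
      by (intro cong_add cong_refl)
    then have "(z + c * b) mod n = (z' + c' * b) mod n"
      unfolding d(1) cong_def by (simp add: algebra_simps)
    moreover have "b < n" using n by (simp add: b_def)
    ultimately show ?thesis by blast
  qed
  show ?thesis
    using *[of c c' z z'] *[of c' c z' z] c by (metis nat_neq_iff)
qed

lemma inj_on_shift_mod: "inj_on (\<lambda>z. (z + k) mod n) {..<n :: nat}"
proof (rule inj_onI)
  fix x y assume *: "x \<in> {..<n}" "y \<in> {..<n}" "(x + k) mod n = (y + k) mod n"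
  then have "[x = y] (mod n)" by (simp add: cong_def[symmetric] cong_add_rcancel_nat)
  then show "x = y" using * cong_less_modulus_unique_nat by auto
qed

text \<open>The partitions that cover all pairs inside a class. Split \<open>{..<q * n1}\<close> into \<open>q\<close> groups of size
  \<open>n1\<close>. Lines cover pairs from distinct groups. A pair \<open>u, u'\<close> in one group is covered by the
  reflection \<open>u \<mapsto> e - u\<close> with \<open>e = u + u'\<close>: of the two parts indexed by the points of an orbit,
  one collects the orbit in the groups below \<open>h\<close> and the other in the groups above \<open>h\<close>, so that
  together with one point of group \<open>h\<close> each part has \<open>q = 2 * h + 1\<close> points. Shifting the groups
  takes care of group \<open>h\<close>.\<close>

definition fold_index :: "nat \<Rightarrow> (nat \<Rightarrow> nat) \<Rightarrow> nat \<Rightarrow> nat \<Rightarrow> nat" where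
  "fold_index h P g u = (if g < h then min u (P u) else if g = h then u else max u (P u))"

text \<open>In a two-point orbit the smaller point collects both points from each of the
  \<open>h\<close> lower groups, the larger one does so in the upper groups, and each gets one more
  point from group \<open>h\<close>. A fixed point of \<open>P\<close> collects itself once from
  every group.\<close>

lemma card_fold_fiber:
  assumes PP: "\<And>u. u < n1 \<Longrightarrow> P (P u) = u"
  shows "card {(g, u). g < 2 * h + 1 \<and> u < n1 \<and> fold_index h P g u = a} \<le> 2 * h + 1"
proof -
  let ?S = "{(g, u). g < 2 * h + 1 \<and> u < n1 \<and> fold_index h P g u = a}"
  have fib: "(g < h \<longrightarrow> (u = a \<or> u = P a) \<and> a \<le> P a) \<and> (g = h \<longrightarrow> u = a) \<and>
      (h < g \<longrightarrow> (u = a \<or> u = P a) \<and> P a \<le> a) \<and> g < 2 * h + 1" if "(g, u) \<in> ?S" for g u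
    using that PP[of u] by (auto simp: fold_index_def min_def max_def split: if_splits)
  have le: "card ?S \<le> card U + card V" if "?S \<subseteq> U \<union> V" "finite U" "finite V" for U V
    using card_mono[OF _ that(1)] card_Un_le[of U V] that by simp
  consider "a < P a" | "P a < a" | "P a = a" by linarith
  then show ?thesis
  proof cases
    assume a: "a < P a"
    have "?S \<subseteq> {..h} \<times> {a} \<union> {..<h} \<times> {P a}"
    proof
      fix p assume p: "p \<in> ?S"
      obtain g u where gu: "p = (g, u)" by fastforce
      show "p \<in> {..h} \<times> {a} \<union> {..<h} \<times> {P a}"
        using fib[OF p[unfolded gu]] a unfolding gu by (cases g h rule: linorder_cases) auto
    qed
    from le[OF this] show ?thesis by simp
  next
    assume a: "P a < a"
    have "?S \<subseteq> {h..2 * h} \<times> {a} \<union> {h<..2 * h} \<times> {P a}"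
    proof
      fix p assume p: "p \<in> ?S"
      obtain g u where gu: "p = (g, u)" by fastforce
      show "p \<in> {h..2 * h} \<times> {a} \<union> {h<..2 * h} \<times> {P a}"
        using fib[OF p[unfolded gu]] a unfolding gu by (cases g h rule: linorder_cases) auto
    qed
    from le[OF this] show ?thesis by simp
  next
    assume a: "P a = a"
    have "?S \<subseteq> {..2 * h} \<times> {a} \<union> {}"
    proof
      fix p assume p: "p \<in> ?S"
      obtain g u where gu: "p = (g, u)" by fastforce
      show "p \<in> {..2 * h} \<times> {a} \<union> {}"
        using fib[OF p[unfolded gu]] a unfolding gu by (cases g h rule: linorder_cases) auto
    qed
    from le[OF this] show ?thesis by simp
  qed
qed

lemma card_grouped_fiber_le:
  fixes n1 q :: nat
  assumes "\<And>y. y < q * n1 \<Longrightarrow> \<phi> y = \<psi> (y div n1) (y mod n1)" "n1 > 0"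
    and \<psi>: "\<And>a. card {(g, u). g < q \<and> u < n1 \<and> \<psi> g u = a} \<le> k"
  shows "card {y. y < q * n1 \<and> \<phi> y = a} \<le> k"
proof -
  have "card {y. y < q * n1 \<and> \<phi> y = a} \<le> card {(g, u). g < q \<and> u < n1 \<and> \<psi> g u = a}"
  proof (rule card_inj_on_le)
    show "inj_on (\<lambda>y. (y div n1, y mod n1)) {y. y < q * n1 \<and> \<phi> y = a}"
      by (rule inj_onI) (metis div_mult_mod_eq prod.inject)
    show "(\<lambda>y. (y div n1, y mod n1)) ` {y. y < q * n1 \<and> \<phi> y = a} \<subseteq> {(g, u). g < q \<and> u < n1 \<and> \<psi> g u = a}"
      using assms(1,2) by (auto simp: less_mult_imp_div_less)
    show "finite {(g, u). g < q \<and> u < n1 \<and> \<psi> g u = a}"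
      by (rule finite_subset[of _ "{..<q} \<times> {..<n1}"]) auto
  qed
  then show ?thesis using \<psi>[of a] by linarith
qed

lemma card_class_fiber_le:
  fixes n1 q :: nat
  assumes "n1 > 0" "\<And>y. y < q * n1 \<Longrightarrow> \<phi> y < n1"
    and fib: "\<And>a. card {y. y < q * n1 \<and> \<phi> y = a} \<le> k"
  shows "card {(c, y). c < q \<and> y < q * n1 \<and> c * n1 + \<phi> y = a} \<le> k"
proof -
  have "card {(c, y). c < q \<and> y < q * n1 \<and> c * n1 + \<phi> y = a} \<le> card {y. y < q * n1 \<and> \<phi> y = a mod n1}"
  proof (rule card_inj_on_le)
    have *: "c = a div n1 \<and> \<phi> y = a mod n1" if "y < q * n1" "c * n1 + \<phi> y = a" for c y
      using assms(2)[OF that(1)] that(2) by auto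
    show "inj_on snd {(c, y). c < q \<and> y < q * n1 \<and> c * n1 + \<phi> y = a}"
      by (rule inj_onI) (use * in auto)
    show "snd ` {(c, y). c < q \<and> y < q * n1 \<and> c * n1 + \<phi> y = a} \<subseteq> {y. y < q * n1 \<and> \<phi> y = a mod n1}"
      using * assms(2) by auto
  qed simp
  then show ?thesis using fib[of "a mod n1"] by linarith
qed

text \<open>Class \<open>c\<close> owns the \<open>n1\<close> part indices starting at
  \<open>c * n1\<close>, so only pairs inside one class need to be covered. The
  \<open>3 * n1\<close> columns are \<open>n1\<close> lines (\<open>A\<close>), \<open>n1\<close>
  reflections (\<open>B 0\<close>), and the same reflections after a shift of the groups by one
  (\<open>B 1\<close>).\<close>

lemma resolvable_pair_cover:
  fixes q n1 R h :: nat
  assumes q: "q = 2 * h + 1" "h > 0" and n1: "n1 > 0" and R: "R \<ge> 3 * n1"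
    and cop: "\<And>d. 0 < d \<Longrightarrow> d < q \<Longrightarrow> coprime d n1"
  obtains \<rho> :: "nat \<Rightarrow> nat \<Rightarrow> nat \<Rightarrow> nat" where
    "\<And>i c y. c < q \<Longrightarrow> y < q * n1 \<Longrightarrow> \<rho> i c y < q * n1"
    "\<And>i a. card {(c, y). c < q \<and> y < q * n1 \<and> \<rho> i c y = a} \<le> q"
    "\<And>c y y'. c < q \<Longrightarrow> y < q * n1 \<Longrightarrow> y' < q * n1 \<Longrightarrow> \<exists>i<R. \<rho> i c y = \<rho> i c y'"
proof -
  define A where "A b y = (y mod n1 + y div n1 * b) mod n1" for b y
  define P where "P e u = (e + (n1 - u)) mod n1" for e u
  define B where "B s e y = fold_index h (P e) ((y div n1 + s) mod q) (y mod n1)" for s e y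
  define \<phi> where "\<phi> i = (if i < n1 then A i else if i < 2 * n1 then B 0 (i - n1) else B 1 (i - 2 * n1))" for i
  have P_lt: "P e u < n1" for e u using n1 by (simp add: P_def)
  have P_eq: "P e u = v" if "u < n1" "v < n1" "[u + v = e] (mod n1)" for e u v
  proof -
    have "[P e u + u = e + (n1 - u) + u] (mod n1)"
      unfolding P_def cong_def by (simp add: mod_add_left_eq)
    also have "e + (n1 - u) + u = e + n1" using that by simp
    also have "[e + n1 = e] (mod n1)" by (simp add: cong_def)
    also have "[e = v + u] (mod n1)" using that(3) by (simp add: cong_sym add.commute)
    finally have "[P e u = v] (mod n1)" by (simp add: cong_add_rcancel_nat)
    then show ?thesis using cong_less_modulus_unique_nat P_lt that(2) by blast
  qed
  have PP: "P e (P e u) = u" if u: "u < n1" for e u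
  proof (rule P_eq[OF P_lt u])
    have "[P e u + u = e + (n1 - u) + u] (mod n1)"
      unfolding P_def cong_def by (simp add: mod_add_left_eq)
    also have "e + (n1 - u) + u = e + n1" using u by simp
    also have "[e + n1 = e] (mod n1)" by (simp add: cong_def)
    finally show "[P e u + u = e] (mod n1)" .
  qed
  have fibA: "card {y. y < q * n1 \<and> A b y = a} \<le> q" for b a
  proof (rule card_grouped_fiber_le)
    show "card {(g, u). g < q \<and> u < n1 \<and> (u + g * b) mod n1 = a} \<le> q" for a
    proof -
      have "card {(g, u). g < q \<and> u < n1 \<and> (u + g * b) mod n1 = a} \<le> card {..<q}"
      proof (rule card_inj_on_le)
        show "inj_on fst {(g, u). g < q \<and> u < n1 \<and> (u + g * b) mod n1 = a}"
        proof (rule inj_onI)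
          fix p p' assume *: "p \<in> {(g, u). g < q \<and> u < n1 \<and> (u + g * b) mod n1 = a}"
            "p' \<in> {(g, u). g < q \<and> u < n1 \<and> (u + g * b) mod n1 = a}" "fst p = fst p'"
          obtain g u u' where p: "p = (g, u)" "p' = (g, u')" using *(3) by (metis prod.collapse)
          show "p = p'" using * inj_onD[OF inj_on_shift_mod[of "g * b" n1], of u u'] unfolding p by simp
        qed
      qed auto
      then show ?thesis by simp
    qed
  qed (auto simp: A_def n1)
  have fibB: "card {y. y < q * n1 \<and> B s e y = a} \<le> q" for s e a
  proof (rule card_grouped_fiber_le)
    show "card {(g, u). g < q \<and> u < n1 \<and> fold_index h (P e) ((g + s) mod q) u = a} \<le> q" for a
    proof -
      have "card {(g, u). g < q \<and> u < n1 \<and> fold_index h (P e) ((g + s) mod q) u = a} \<le>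
          card {(g, u). g < q \<and> u < n1 \<and> fold_index h (P e) g u = a}"
      proof (rule card_inj_on_le)
        show "inj_on (\<lambda>(g, u). ((g + s) mod q, u)) {(g, u). g < q \<and> u < n1 \<and> fold_index h (P e) ((g + s) mod q) u = a}"
        proof (rule inj_onI)
          fix p p' assume *: "p \<in> {(g, u). g < q \<and> u < n1 \<and> fold_index h (P e) ((g + s) mod q) u = a}"
            "p' \<in> {(g, u). g < q \<and> u < n1 \<and> fold_index h (P e) ((g + s) mod q) u = a}"
            "(case p of (g, u) \<Rightarrow> ((g + s) mod q, u)) = (case p' of (g, u) \<Rightarrow> ((g + s) mod q, u))"
          obtain g u g' u' where p: "p = (g, u)" "p' = (g', u')" by (metis prod.collapse)
          show "p = p'" using * inj_onD[OF inj_on_shift_mod[of s q], of g g'] unfolding p by simp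
        qed
        show "finite {(g, u). g < q \<and> u < n1 \<and> fold_index h (P e) g u = a}"
          by (rule finite_subset[of _ "{..<q} \<times> {..<n1}"]) auto
      qed (use q in auto)
      also have "\<dots> \<le> q" unfolding q(1) by (rule card_fold_fiber) (rule PP)
      finally show ?thesis .
    qed
  qed (auto simp: B_def n1)
  have "fold_index h (P e) g u < n1" if "u < n1" for e g u
    using that P_lt by (simp add: fold_index_def min_def max_def)
  then have lt: "\<phi> i y < n1" for i y
    using n1 by (simp add: \<phi>_def A_def B_def)
  have fib: "card {y. y < q * n1 \<and> \<phi> i y = a} \<le> q" for i a
    unfolding \<phi>_def using fibA fibB by simp
  show thesis
  proof (rule that[of "\<lambda>i c y. c * n1 + \<phi> i y"])
    show "c * n1 + \<phi> i y < q * n1" if "c < q" for i c y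
    proof -
      have "c * n1 + \<phi> i y < Suc c * n1" using lt by simp
      also have "\<dots> \<le> q * n1" using that by (intro mult_right_mono) auto
      finally show ?thesis .
    qed
    show "card {(c, y). c < q \<and> y < q * n1 \<and> c * n1 + \<phi> i y = a} \<le> q" for i a
      by (rule card_class_fiber_le[OF n1 lt fib])
    show "\<exists>i<R. c * n1 + \<phi> i y = c * n1 + \<phi> i y'" if y: "y < q * n1" "y' < q * n1" for c y y'
    proof (cases "y div n1 = y' div n1")
      case False
      have "\<exists>b<n1. A b y = A b y'" unfolding A_def
        by (rule lines_meet[OF n1 cop]) (use y False in \<open>auto simp: less_mult_imp_div_less\<close>)
      then obtain b where "b < n1" "A b y = A b y'" by blast
      then show ?thesis using R by (intro exI[of _ b]) (auto simp: \<phi>_def)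
    next
      case True
      define e where "e = (y mod n1 + y' mod n1) mod n1"
      \<comment> \<open>Reflections do not join points of group \<open>h\<close>; the shift moves a
        pair lying there to another group.\<close>
      define s :: nat where "s = (if y div n1 = h then 1 else 0)"
      have e: "e < n1" using n1 by (simp add: e_def)
      have P1: "P e (y mod n1) = y' mod n1"
        by (rule P_eq) (use n1 in \<open>auto simp: e_def cong_def\<close>)
      have P2: "P e (y' mod n1) = y mod n1" using PP[of "y mod n1" e] P1 n1 by simp
      have "y div n1 < q" using y by (simp add: less_mult_imp_div_less)
      then have "(y div n1 + s) mod q \<noteq> h" using q by (auto simp: s_def)
      then have "B s e y = B s e y'"
        unfolding B_def fold_index_def P1 P2 True by (simp add: min.commute max.commute)
      then show ?thesis using R e
        by (intro exI[of _ "e + (s + 1) * n1"]) (auto simp: \<phi>_def s_def)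
    qed
  qed
qed

section \<open>The recursive construction\<close>

text \<open>Vertices are triples: \<open>(0, b, a)\<close> and \<open>(1, i, a)\<close> are the \<open>a\<close>-th parts of the columns of the two
  kinds, and \<open>(2, x, 0)\<close> is the vertex \<open>x\<close> of \<open>H\<close>. The sets \<open>S1\<close> and \<open>S2\<close> in the last assumption are the
  columns met by a putative cover and \<open>T\<close> is its trace on \<open>H\<close>.\<close>

locale column_scheme =
  fixes n q R :: nat and F :: "nat \<Rightarrow> nat set"
    and lam rho :: "nat \<Rightarrow> nat \<Rightarrow> nat \<Rightarrow> nat"
    and H :: "nat set set" and adj1 adj2 :: "nat \<Rightarrow> nat set \<Rightarrow> bool"
  assumes n: "n \<ge> 8" and q: "q > 0" and R: "R > 0" and F: "doubling n F"
    and lam_lt: "\<And>b c z. c < q \<Longrightarrow> z < n \<Longrightarrow> lam b c z < n"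
    and lam_inj: "\<And>b c. c < q \<Longrightarrow> inj_on (lam b c) {..<n}"
    and lam_meet: "\<And>c c' z z'. c < q \<Longrightarrow> c' < q \<Longrightarrow> c \<noteq> c' \<Longrightarrow> z < n \<Longrightarrow> z' < n \<Longrightarrow>
      \<exists>b<n. lam b c z = lam b c' z'"
    and rho_lt: "\<And>i c y. c < q \<Longrightarrow> y < n \<Longrightarrow> rho i c y < n"
    and rho_card: "\<And>i a. card {(c, y). c < q \<and> y < n \<and> rho i c y = a} \<le> q"
    and rho_meet: "\<And>c y y'. c < q \<Longrightarrow> y < n \<Longrightarrow> y' < n \<Longrightarrow> \<exists>i<R. rho i c y = rho i c y'"
    and H: "crit R H"
    and adj: "\<And>T S1 S2. finite T \<Longrightarrow> S1 \<subseteq> {..<n} \<Longrightarrow> S2 \<subseteq> {..<R} \<Longrightarrow>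
      card T + card S1 + card S2 < n + R \<Longrightarrow>
      card S1 + 2 * card T + 2 \<le> 2 * R \<or> card S2 + 2 * card T + 2 \<le> 2 * R \<Longrightarrow>
      \<exists>h\<in>H. T \<inter> h = {} \<and> ((\<exists>b<n. b \<notin> S1 \<and> adj1 b h) \<or> (\<exists>i<R. i \<notin> S2 \<and> adj2 i h))"
begin

text \<open>Joining in either direction makes a non-adjacent pair separated both ways, as
  \<open>doubling_separation\<close> requires.\<close>

definition G :: "(nat \<times> nat) set" where
  "G = {(z, y). z < n \<and> y < n \<and> (y \<in> F z \<or> z \<in> F y)}"

definition row :: "nat \<Rightarrow> nat \<Rightarrow> nat \<Rightarrow> (nat \<times> nat \<times> nat) set" where
  "row c z y = (\<lambda>b. (0, b, lam b c z)) ` {..<n} \<union> (\<lambda>i. (1, i, rho i c y)) ` {..<R}"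

definition col :: "nat \<Rightarrow> nat \<Rightarrow> nat set \<Rightarrow> (nat \<times> nat \<times> nat) set" where
  "col t k h = (\<lambda>a. (t, k, a)) ` {..<n} \<union> (\<lambda>x. (2, x, 0)) ` h"

definition rows :: "(nat \<times> nat \<times> nat) set set" where
  "rows = (\<lambda>(c, z, y). row c z y) ` ({..<q} \<times> G)"

definition cols :: "nat \<Rightarrow> nat \<Rightarrow> (nat \<Rightarrow> nat set \<Rightarrow> bool) \<Rightarrow> (nat \<times> nat \<times> nat) set set" where
  "cols t N adj = (\<lambda>(k, h). col t k h) ` {(k, h). k < N \<and> h \<in> H \<and> adj k h}"

definition edges :: "(nat \<times> nat \<times> nat) set set" where
  "edges = rows \<union> cols 0 n adj1 \<union> cols 1 R adj2"

lemma G_subset: "G \<subseteq> {..<n} \<times> {..<n}"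
  by (auto simp: G_def)

lemma card_G: "card G \<le> 58 * n"
proof -
  have Fz: "card (F z) \<le> 29" "F z \<subseteq> {..<n}" if "z < n" for z
    using F that by (auto simp: doubling_def)
  have S: "card (SIGMA z:{..<n}. F z) \<le> 29 * n"
  proof -
    have "card (SIGMA z:{..<n}. F z) = (\<Sum>z<n. card (F z))"
      using Fz by (intro card_SigmaI) (auto dest: finite_subset)
    also have "\<dots> \<le> (\<Sum>z<n. 29)" using Fz by (intro sum_mono) auto
    finally show ?thesis by simp
  qed
  have fS: "finite (SIGMA z:{..<n}. F z)"
    by (rule finite_subset[of _ "{..<n} \<times> {..<n}"]) (use Fz in auto)
  have "G \<subseteq> (SIGMA z:{..<n}. F z) \<union> prod.swap ` (SIGMA z:{..<n}. F z)"
  proof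
    fix p assume "p \<in> G"
    then obtain z y where p: "p = (z, y)" "z < n" "y < n" "y \<in> F z \<or> z \<in> F y"
      by (auto simp: G_def)
    from p(4) show "p \<in> (SIGMA z:{..<n}. F z) \<union> prod.swap ` (SIGMA z:{..<n}. F z)"
    proof
      assume "y \<in> F z" then show ?thesis using p by simp
    next
      assume "z \<in> F y"
      then have "(y, z) \<in> (SIGMA z:{..<n}. F z)" using p by simp
      then have "prod.swap (y, z) \<in> prod.swap ` (SIGMA z:{..<n}. F z)" by (rule imageI)
      then show ?thesis using p by simp
    qed
  qed
  then have "card G \<le> card ((SIGMA z:{..<n}. F z) \<union> prod.swap ` (SIGMA z:{..<n}. F z))"
    using fS by (intro card_mono) auto
  also have "\<dots> \<le> card (SIGMA z:{..<n}. F z) + card (prod.swap ` (SIGMA z:{..<n}. F z))"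
    by (rule card_Un_le)
  also have "\<dots> \<le> 29 * n + 29 * n"
    using S card_image_le[OF fS, of prod.swap] by linarith
  finally show ?thesis by simp
qed

lemma finite_G: "finite G"
  using G_subset by (rule finite_subset) simp

lemma finite_adj: "finite {(k, h). k < (N::nat) \<and> h \<in> H \<and> a k h}"
  by (rule finite_subset[of _ "{..<N} \<times> H"]) (use crit_finite[OF H] in auto)

lemma finite_edges: "finite edges"
  unfolding edges_def rows_def cols_def using finite_G finite_adj by (intro finite_UnI finite_imageI finite_cartesian_product) simp_all

lemma card_edges:
  "card edges \<le> 58 * q * n + card {(b, h). b < n \<and> h \<in> H \<and> adj1 b h}
     + card {(i, h). i < R \<and> h \<in> H \<and> adj2 i h}"
proof -
  have "card rows \<le> card ({..<q} \<times> G)"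
    unfolding rows_def using finite_G by (intro card_image_le) simp
  also have "\<dots> \<le> q * (58 * n)" using card_G by (simp add: card_cartesian_product)
  finally have 1: "card rows \<le> 58 * q * n" by simp
  have 2: "card (cols t N a) \<le> card {(k, h). k < N \<and> h \<in> H \<and> a k h}" for t N a
    unfolding cols_def by (rule card_image_le[OF finite_adj])
  have "card edges \<le> card rows + card (cols 0 n adj1) + card (cols 1 R adj2)"
    unfolding edges_def using card_Un_le[of rows "cols 0 n adj1"]
      card_Un_le[of "rows \<union> cols 0 n adj1" "cols 1 R adj2"] by linarith
  then show ?thesis using 1 2[of 0 n adj1] 2[of 1 R adj2] by linarith
qed

section \<open>Uniformity and intersections of the edges\<close>

lemma row_uniform: "finite (row c z y)" "card (row c z y) = n + R"
proof -
  show "finite (row c z y)" by (simp add: row_def)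
  have "card (row c z y) = card ((\<lambda>b. (0::nat, b, lam b c z)) ` {..<n}) + card ((\<lambda>i. (1::nat, i, rho i c y)) ` {..<R})"
    unfolding row_def by (intro card_Un_disjoint) auto
  then show "card (row c z y) = n + R" by (simp add: card_image inj_on_def)
qed

lemma col_uniform:
  assumes "t \<noteq> 2" "h \<in> H"
  shows "finite (col t k h)" "card (col t k h) = n + R"
proof -
  have h: "finite h" "card h = R" using crit_uniform[OF H assms(2)] by auto
  then show "finite (col t k h)" by (simp add: col_def)
  have "card (col t k h) = card ((\<lambda>a. (t, k, a)) ` {..<n}) + card ((\<lambda>x. (2::nat, x, 0::nat)) ` h)"
    unfolding col_def using h assms(1) by (intro card_Un_disjoint) auto
  then show "card (col t k h) = n + R" using h by (simp add: card_image inj_on_def)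
qed

text \<open>Rows of distinct classes meet in one of the first \<open>n\<close> columns, rows of the
  same class in one of the last \<open>R\<close>.\<close>

lemma rows_meet:
  assumes "c < q" "c' < q" "z < n" "y < n" "z' < n" "y' < n"
  shows "row c z y \<inter> row c' z' y' \<noteq> {}"
proof (cases "c = c'")
  case True
  then obtain i where i: "i < R" "rho i c y = rho i c' y'" using rho_meet[of c y y'] assms by auto
  have "(1, i, rho i c y) \<in> row c z y" unfolding row_def using i(1) by blast
  moreover have "(1, i, rho i c y) \<in> row c' z' y'" unfolding i(2) row_def using i(1) by blast
  ultimately show ?thesis by blast
next
  case False
  then obtain b where b: "b < n" "lam b c z = lam b c' z'" using lam_meet[of c c' z z'] assms by auto
  have "(0, b, lam b c z) \<in> row c z y" unfolding row_def using b(1) by blast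
  moreover have "(0, b, lam b c z) \<in> row c' z' y'" unfolding b(2) row_def using b(1) by blast
  ultimately show ?thesis by blast
qed

lemma row_col0_meet:
  assumes "c < q" "z < n" "b < n"
  shows "row c z y \<inter> col 0 b h \<noteq> {}"
proof -
  have "(0, b, lam b c z) \<in> row c z y" "(0, b, lam b c z) \<in> col 0 b h"
    using assms lam_lt by (auto simp: row_def col_def)
  then show ?thesis by blast
qed

lemma row_col1_meet:
  assumes "c < q" "y < n" "i < R"
  shows "row c z y \<inter> col 1 i h \<noteq> {}"
proof -
  have "(1, i, rho i c y) \<in> row c z y" "(1, i, rho i c y) \<in> col 1 i h"
    using assms rho_lt by (auto simp: row_def col_def)
  then show ?thesis by blast
qed

lemma cols_meet:
  assumes "h \<in> H" "h' \<in> H"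
  shows "col t k h \<inter> col t' k' h' \<noteq> {}"
proof -
  obtain x where "x \<in> h" "x \<in> h'" using crit_meet[OF H assms] by blast
  then have "(2, x, 0) \<in> col t k h \<inter> col t' k' h'" by (simp add: col_def)
  then show ?thesis by blast
qed

lemma edgeE:
  assumes "e \<in> edges"
  obtains c z y where "e = row c z y" "c < q" "z < n" "y < n"
    | b h where "e = col 0 b h" "b < n" "h \<in> H"
    | i h where "e = col 1 i h" "i < R" "h \<in> H"
  using assms G_subset unfolding edges_def rows_def cols_def by auto

text \<open>\<open>A c\<close> and \<open>B c\<close> are the points that \<open>T\<close> misses
  within class \<open>c\<close>, by columns of the first and of the second kind. A pair of
  \<open>G\<close> between them would be a missed row, so the two sets are separated and expansion
  applies.\<close>

lemma rigidity:
  assumes T: "finite T" and cover: "\<And>c z y. c < q \<Longrightarrow> (z, y) \<in> G \<Longrightarrow> T \<inter> row c z y \<noteq> {}"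
  defines "T1 \<equiv> {(b, a). (0, b, a) \<in> T}" and "T2 \<equiv> {(i, a). (1, i, a) \<in> T}"
  shows "2 * n \<le> 2 * card T1 + card T2 \<or> 2 * n \<le> card T1 + 2 * card T2"
proof -
  have fT: "finite T1" "finite T2"
  proof -
    have "T1 \<subseteq> snd ` T" "T2 \<subseteq> snd ` T" unfolding T1_def T2_def by (auto intro: rev_image_eqI)
    then show "finite T1" "finite T2" using T by (auto intro: finite_subset)
  qed
  define A where "A c = {z. z < n \<and> (\<forall>b<n. (b, lam b c z) \<notin> T1)}" for c
  define B where "B c = {y. y < n \<and> (\<forall>i<R. (i, rho i c y) \<notin> T2)}" for c
  \<comment> \<open>For fixed \<open>c\<close> a part of the first kind contains at most one
    \<open>z\<close>, so this bound holds in every class.\<close>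
  have A: "n \<le> card (A c) + card T1" if c: "c < q" for c
  proof -
    have "\<forall>z\<in>{..<n} - A c. \<exists>b. (b, lam b c z) \<in> T1" by (auto simp: A_def)
    then obtain \<beta> where \<beta>: "\<And>z. z \<in> {..<n} - A c \<Longrightarrow> (\<beta> z, lam (\<beta> z) c z) \<in> T1" by metis
    have "card ({..<n} - A c) \<le> card T1"
    proof (rule card_inj_on_le[of "\<lambda>z. (\<beta> z, lam (\<beta> z) c z)"])
      show "inj_on (\<lambda>z. (\<beta> z, lam (\<beta> z) c z)) ({..<n} - A c)"
      proof (rule inj_onI)
        fix z z' assume *: "z \<in> {..<n} - A c" "z' \<in> {..<n} - A c"
          "(\<beta> z, lam (\<beta> z) c z) = (\<beta> z', lam (\<beta> z') c z')"
        then have "lam (\<beta> z) c z = lam (\<beta> z) c z'" by auto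
        then show "z = z'" using inj_onD[OF lam_inj[OF c]] * by blast
      qed
    qed (use \<beta> fT in auto)
    moreover have "card ({..<n} - A c) = n - card (A c)"
      by (subst card_Diff_subset) (auto simp: A_def)
    ultimately show ?thesis by linarith
  qed
  \<comment> \<open>A part of the second kind may contain up to \<open>q\<close> points of a single
    class, so here averaging over the \<open>q\<close> classes is used to find one good
    class.\<close>
  have "\<exists>c<q. n \<le> card (B c) + card T2"
  proof (rule ccontr)
    assume neg: "\<not> ?thesis"
    define U where "U = (SIGMA c:{..<q}. {..<n} - B c)"
    have "U \<subseteq> (\<Union>p\<in>T2. {(c, y). c < q \<and> y < n \<and> rho (fst p) c y = snd p})"
    proof
      fix x assume "x \<in> U"
      then obtain c y where x: "x = (c, y)" "c < q" "y < n" "y \<notin> B c" by (auto simp: U_def)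
      then obtain i where "(i, rho i c y) \<in> T2" by (auto simp: B_def)
      then show "x \<in> (\<Union>p\<in>T2. {(c, y). c < q \<and> y < n \<and> rho (fst p) c y = snd p})"
        by (rule UN_I) (use x in simp)
    qed
    moreover have "finite {(c, y). c < q \<and> y < n \<and> rho (fst p) c y = snd p}" for p
      by (rule finite_subset[of _ "{..<q} \<times> {..<n}"]) auto
    ultimately have "card U \<le> card (\<Union>p\<in>T2. {(c, y). c < q \<and> y < n \<and> rho (fst p) c y = snd p})"
      using fT by (intro card_mono) auto
    also have "\<dots> \<le> (\<Sum>p\<in>T2. card {(c, y). c < q \<and> y < n \<and> rho (fst p) c y = snd p})"
      by (rule card_UN_le[OF fT(2)])
    also have "\<dots> \<le> (\<Sum>p\<in>T2. q)" using rho_card by (intro sum_mono)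
    finally have "card U \<le> q * card T2" by (simp add: mult.commute)
    moreover have "card U = (\<Sum>c<q. n - card (B c))"
    proof -
      have "card U = (\<Sum>c<q. card ({..<n} - B c))" unfolding U_def by (rule card_SigmaI) auto
      also have "\<dots> = (\<Sum>c<q. n - card (B c))"
        by (intro sum.cong refl) (subst card_Diff_subset, auto simp: B_def)
      finally show ?thesis .
    qed
    moreover have "(\<Sum>c<q. card T2) < (\<Sum>c<q. n - card (B c))"
      using neg q by (intro sum_strict_mono) auto
    ultimately show False by simp
  qed
  then obtain c where c: "c < q" "n \<le> card (B c) + card T2" by blast
  have "2 * card (A c) + card (B c) \<le> n \<or> card (A c) + 2 * card (B c) \<le> n"
  proof (rule doubling_separation[OF F n])
    show "A c \<subseteq> {..<n}" "B c \<subseteq> {..<n}" by (auto simp: A_def B_def)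
    fix z y assume zy: "z \<in> A c" "y \<in> B c"
    have "T \<inter> row c z y = {}" using zy by (auto simp: row_def A_def B_def T1_def T2_def)
    then have "(z, y) \<notin> G" using cover[OF c(1)] by blast
    then show "y \<notin> F z \<and> z \<notin> F y" using zy by (auto simp: G_def A_def B_def)
  qed
  then show ?thesis using A[OF c(1)] c(2) by linarith
qed

lemma no_small_cover:
  assumes T: "finite T" "card T < n + R"
  shows "\<exists>e\<in>edges. T \<inter> e = {}"
proof (rule ccontr)
  assume neg: "\<not> ?thesis"
  define T0 where "T0 = {x. (2, x, 0) \<in> T}"
  define T1 where "T1 = {(b, a). (0, b, a) \<in> T}"
  define T2 where "T2 = {(i, a). (1, i, a) \<in> T}"
  have sub: "T0 \<subseteq> (fst \<circ> snd) ` T" "T1 \<subseteq> snd ` T" "T2 \<subseteq> snd ` T"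
    unfolding T0_def T1_def T2_def by (force simp: image_iff)+
  have fin: "finite T0" "finite T1" "finite T2" by (rule finite_subset[OF sub(1)], use T in simp)
    (rule finite_subset[OF sub(2)], use T in simp, rule finite_subset[OF sub(3)], use T in simp)
  have "card T0 + card T1 + card T2 \<le> card T"
  proof -
    let ?I0 = "(\<lambda>x. (2::nat, x, 0::nat)) ` T0"
    let ?I1 = "(\<lambda>p. (0::nat, p)) ` T1" and ?I2 = "(\<lambda>p. (1::nat, p)) ` T2"
    have "card ?I0 = card T0" "card ?I1 = card T1" "card ?I2 = card T2"
      by (auto intro!: card_image inj_onI)
    moreover have "card (?I0 \<union> ?I1 \<union> ?I2) = card ?I0 + card ?I1 + card ?I2"
    proof -
      have "card (?I0 \<union> ?I1) = card ?I0 + card ?I1" using fin by (intro card_Un_disjoint) auto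
      moreover have "card (?I0 \<union> ?I1 \<union> ?I2) = card (?I0 \<union> ?I1) + card ?I2"
        using fin by (intro card_Un_disjoint) auto
      ultimately show ?thesis by simp
    qed
    moreover have "?I0 \<union> ?I1 \<union> ?I2 \<subseteq> T" by (auto simp: T0_def T1_def T2_def)
    then have "card (?I0 \<union> ?I1 \<union> ?I2) \<le> card T" using T by (intro card_mono)
    ultimately show ?thesis by linarith
  qed
  then have sum: "card T0 + card T1 + card T2 < n + R" using T by linarith
  have cover: "T \<inter> row c z y \<noteq> {}" if "c < q" "(z, y) \<in> G" for c z y
  proof -
    have "row c z y \<in> edges" unfolding edges_def rows_def
      by (intro UnI1 image_eqI[where x = "(c, z, y)"]) (use that in auto)
    then show ?thesis using neg by blast
  qed
  have rig: "2 * n \<le> 2 * card T1 + card T2 \<or> 2 * n \<le> card T1 + 2 * card T2"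
    using rigidity[OF T(1) cover] unfolding T1_def T2_def .
  define S1 where "S1 = fst ` T1 \<inter> {..<n}"
  define S2 where "S2 = fst ` T2 \<inter> {..<R}"
  have "card S1 \<le> card (fst ` T1)" "card S2 \<le> card (fst ` T2)"
    using fin by (auto simp: S1_def S2_def intro: card_mono)
  then have S: "card S1 \<le> card T1" "card S2 \<le> card T2"
    using card_image_le[OF fin(2), of fst] card_image_le[OF fin(3), of fst] by auto
  have "\<exists>h\<in>H. T0 \<inter> h = {} \<and> ((\<exists>b<n. b \<notin> S1 \<and> adj1 b h) \<or> (\<exists>i<R. i \<notin> S2 \<and> adj2 i h))"
  proof (rule adj[OF fin(1)])
    show "S1 \<subseteq> {..<n}" "S2 \<subseteq> {..<R}" by (auto simp: S1_def S2_def)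
    show "card T0 + card S1 + card S2 < n + R" using sum S by linarith
    \<comment> \<open>As \<open>T1\<close> and \<open>T2\<close> together have at most
      \<open>n + R - card T0 - 1\<close> points, the alternatives in \<open>rig\<close> bound
      \<open>card T2\<close> or \<open>card T1\<close> by
      \<open>2 * (R - card T0 - 1)\<close>.\<close>
    show "card S1 + 2 * card T0 + 2 \<le> 2 * R \<or> card S2 + 2 * card T0 + 2 \<le> 2 * R"
      using rig sum S by linarith
  qed
  then obtain h where h: "h \<in> H" "T0 \<inter> h = {}"
    and hit: "(\<exists>b<n. b \<notin> S1 \<and> adj1 b h) \<or> (\<exists>i<R. i \<notin> S2 \<and> adj2 i h)" by blast
  from hit show False
  proof
    assume "\<exists>b<n. b \<notin> S1 \<and> adj1 b h"
    then obtain b where b: "b < n" "b \<notin> S1" "adj1 b h" by blast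
    have "col 0 b h \<in> edges" unfolding edges_def cols_def
      by (intro UnI1 UnI2 image_eqI[where x = "(b, h)"]) (use b h in auto)
    moreover have "T \<inter> col 0 b h = {}"
      using b h(2) by (force simp: col_def S1_def T1_def T0_def image_iff)
    ultimately show False using neg by blast
  next
    assume "\<exists>i<R. i \<notin> S2 \<and> adj2 i h"
    then obtain i where i: "i < R" "i \<notin> S2" "adj2 i h" by blast
    have "col 1 i h \<in> edges" unfolding edges_def cols_def
      by (intro UnI2 image_eqI[where x = "(i, h)"]) (use i h in auto)
    moreover have "T \<inter> col 1 i h = {}"
      using i h(2) by (force simp: col_def S2_def T2_def T0_def image_iff)
    ultimately show False using neg by blast
  qed
qed

lemma crit_edges: "crit (n + R) edges"
proof (rule critI)
  show "finite edges" by (rule finite_edges)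
  show "finite e" "card e = n + R" if "e \<in> edges" for e
    using that by (cases rule: edgeE; simp add: row_uniform col_uniform)+
  show "e \<inter> f \<noteq> {}" if e: "e \<in> edges" and f: "f \<in> edges" for e f
    using e
  proof (cases rule: edgeE)
    case 1
    from f show ?thesis
      by (cases rule: edgeE) (use 1 rows_meet row_col0_meet row_col1_meet in metis)+
  next
    case 2
    from f show ?thesis
      by (cases rule: edgeE) (use 2 cols_meet row_col0_meet in \<open>metis Int_commute\<close>)+
  next
    case 3
    from f show ?thesis
      by (cases rule: edgeE) (use 3 cols_meet row_col1_meet in \<open>metis Int_commute\<close>)+
  qed
qed (rule no_small_cover)

section \<open>Diagonal rows\<close>

lemma diagonal_row_edge: "c < q \<Longrightarrow> z < n \<Longrightarrow> row c z z \<in> edges"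
  unfolding edges_def rows_def
  by (intro UnI1 image_eqI[where x = "(c, z, z)"]) (use F in \<open>auto simp: G_def doubling_def\<close>)

text \<open>This makes the new hypergraph \<open>dispersed\<close>. A part of the first kind
  contains at most one \<open>z\<close> per class, parts of the second kind are bounded by
  \<open>rho_card\<close>, and no other vertex lies on a row.\<close>

lemma card_diagonal_rows: "card {(c, z). c < q \<and> z < n \<and> x \<in> row c z z} \<le> q"
proof -
  obtain t k a where x: "x = (t, k, a)" by (metis prod_cases3)
  show ?thesis
  proof (cases "t = 0")
    case True
    have "card {(c, z). c < q \<and> z < n \<and> x \<in> row c z z} \<le> card {..<q}"
    proof (rule card_inj_on_le[of fst])
      show "inj_on fst {(c, z). c < q \<and> z < n \<and> x \<in> row c z z}"
      proof (rule inj_onI)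
        fix p p' assume *: "p \<in> {(c, z). c < q \<and> z < n \<and> x \<in> row c z z}"
          "p' \<in> {(c, z). c < q \<and> z < n \<and> x \<in> row c z z}" "fst p = fst p'"
        obtain c z z' where p: "p = (c, z)" "p' = (c, z')" using *(3) by (metis prod.collapse)
        have "lam k c z = lam k c z'" using *(1,2) True unfolding p x row_def by auto
        then show "p = p'" using * inj_onD[OF lam_inj[of c k], of z z'] unfolding p by auto
      qed
    qed auto
    then show ?thesis by simp
  next
    case False
    have "card {(c, z). c < q \<and> z < n \<and> x \<in> row c z z} \<le> card {(c, y). c < q \<and> y < n \<and> rho k c y = a}"
    proof (rule card_mono)
      show "finite {(c, y). c < q \<and> y < n \<and> rho k c y = a}"
        by (rule finite_subset[of _ "{..<q} \<times> {..<n}"]) auto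
    qed (use False in \<open>auto simp: x row_def\<close>)
    then show ?thesis using rho_card[of k a] by linarith
  qed
qed

end

section \<open>Sparse choice of the column edges\<close>

text \<open>What the next level of the recursion needs of its \<open>H\<close>: \<open>v\<close>
  points meet at most \<open>q * v\<close> of the pairs \<open>(c, z)\<close>, so any
  \<open>v + 1\<close> values of \<open>z\<close> include one with a missed \<open>K c z\<close>.
  The number \<open>m\<close> of values is almost \<open>r\<close>.\<close>

definition dispersed :: "nat \<Rightarrow> nat \<Rightarrow> 'a set set \<Rightarrow> bool" where
  "dispersed q r E \<longleftrightarrow> (\<exists>m K. q * r \<le> (q + 4) * m \<and> (\<forall>c<q. \<forall>z<m. K c z \<in> E) \<and>
     (\<forall>x. card {(c, z). c < q \<and> z < m \<and> x \<in> K c z} \<le> q))"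

lemma dispersed_image:
  assumes E: "dispersed q r E" and f: "inj_on f (\<Union>E)"
  shows "dispersed q r ((`) f ` E)"
proof -
  obtain m K where m: "q * r \<le> (q + 4) * m" and K: "\<And>c z. c < q \<Longrightarrow> z < m \<Longrightarrow> K c z \<in> E"
    and card: "\<And>x. card {(c, z). c < q \<and> z < m \<and> x \<in> K c z} \<le> q"
    using E unfolding dispersed_def by blast
  have "card {(c, z). c < q \<and> z < m \<and> x \<in> f ` K c z} \<le> q" for x
  proof (cases "x \<in> f ` \<Union>E")
    case True
    then obtain y where y: "y \<in> \<Union>E" "x = f y" by blast
    have sub: "{(c, z). c < q \<and> z < m \<and> x \<in> f ` K c z} \<subseteq> {(c, z). c < q \<and> z < m \<and> y \<in> K c z}"
    proof clarify
      fix c z w assume *: "c < q" "z < m" "x = f w" "w \<in> K c z"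
      have "w \<in> \<Union>E" by (rule UnionI[OF K[OF *(1,2)] *(4)])
      then have "w = y" using inj_onD[OF f _ _ y(1)] y(2) *(3) by simp
      then show "y \<in> K c z" using *(4) by simp
    qed
    have "finite {(c, z). c < q \<and> z < m \<and> y \<in> K c z}"
      by (rule finite_subset[of _ "{..<q} \<times> {..<m}"]) auto
    then have "card {(c, z). c < q \<and> z < m \<and> x \<in> f ` K c z} \<le> card {(c, z). c < q \<and> z < m \<and> y \<in> K c z}"
      by (rule card_mono[OF _ sub])
    then show ?thesis using card[of y] by linarith
  next
    case False
    then have "x \<notin> f ` K c z" if "c < q" "z < m" for c z
      using UnionI[OF K[OF that]] by auto
    then have "{(c, z). c < q \<and> z < m \<and> x \<in> f ` K c z} = {}" by auto
    then show ?thesis unfolding \<open>_ = {}\<close> by simp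
  qed
  moreover have "\<forall>c<q. \<forall>z<m. f ` K c z \<in> (`) f ` E" using K by simp
  ultimately show ?thesis unfolding dispersed_def using m
    by (intro exI[of _ m] exI[of _ "\<lambda>c z. f ` K c z"]) simp
qed

text \<open>\<open>lab h\<close> numbers a vertex common to \<open>h\<close> and a fixed edge
  \<open>h0\<close>. Each edge missed by \<open>T\<close> contains its own such vertex, so
  \<open>T\<close> together with these vertices is a cover and has at least \<open>R\<close>
  points.\<close>

lemma missed_labels:
  assumes H: "crit R (H :: nat set set)" and R: "R > 0"
  obtains lab :: "nat set \<Rightarrow> nat" where "\<And>h. h \<in> H \<Longrightarrow> lab h < R"
    "\<And>T. finite T \<Longrightarrow> R \<le> card T + card (lab ` {h \<in> H. T \<inter> h = {}})"
proof -
  obtain h0 where h0: "h0 \<in> H" using crit_missed[OF H, of "{}"] R by auto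
  then have f0: "finite h0" "card h0 = R" using crit_uniform[OF H] by auto
  obtain g where g: "bij_betw g h0 {..<R}"
    using ex_bij_betw_finite_nat[OF f0(1)] unfolding f0(2) atLeast0LessThan by blast
  have "\<exists>x. x \<in> h \<and> x \<in> h0" if "h \<in> H" for h using crit_meet[OF H that h0] by blast
  then obtain v where v: "\<And>h. h \<in> H \<Longrightarrow> v h \<in> h \<and> v h \<in> h0" by metis
  show thesis
  proof (rule that[of "\<lambda>h. g (v h)"])
    show "g (v h) < R" if "h \<in> H" for h using bij_betwE[OF g] v[OF that] by blast
    fix T :: "nat set" assume T: "finite T"
    let ?U = "{h \<in> H. T \<inter> h = {}}"
    have fU: "finite ?U" using crit_finite[OF H] by simp
    have "v ` ?U \<subseteq> h0" using v by blast
    then have "inj_on g (v ` ?U)" using bij_betw_imp_inj_on[OF g] inj_on_subset by blast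
    then have eq: "card ((\<lambda>h. g (v h)) ` ?U) = card (v ` ?U)"
      using card_image[of g "v ` ?U"] by (simp add: image_image)
    have "R \<le> card (T \<union> v ` ?U)"
    proof (rule ccontr)
      assume "\<not> ?thesis"
      then have lt: "card (T \<union> v ` ?U) < R" by simp
      have "finite (T \<union> v ` ?U)" using T fU by simp
      then obtain h where h: "h \<in> H" "(T \<union> v ` ?U) \<inter> h = {}"
        using lt by (rule crit_missed[OF H])
      then have "v h \<in> v ` ?U" by blast
      then show False using v[OF h(1)] h(2) by blast
    qed
    also have "\<dots> \<le> card T + card (v ` ?U)" by (rule card_Un_le)
    finally show "R \<le> card T + card ((\<lambda>h. g (v h)) ` ?U)" using eq by simp
  qed
qed

lemma card_spread_pairs:
  assumes F: "doubling m F" and m: "m > 0"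
  shows "finite ((\<lambda>(b, c, z). (b, K c z)) ` (SIGMA b:{..<N}. {..<q} \<times> spread F l ((d + b) mod m)))"
    "card ((\<lambda>(b, c, z). (b, K c z)) ` (SIGMA b:{..<N::nat}. {..<q::nat} \<times> spread F l ((d + b) mod m)))
      \<le> N * (q * 29 ^ l)"
proof -
  let ?S = "SIGMA b:{..<N}. {..<q} \<times> spread F l ((d + b) mod m)"
  have s: "finite (spread F l ((d + b) mod m))" for b
    using spread_subset[OF F, of "(d + b) mod m"] m by (meson finite_lessThan finite_subset mod_less_divisor)
  then have fS: "finite ?S" by auto
  then show "finite ((\<lambda>(b, c, z). (b, K c z)) ` ?S)" by (rule finite_imageI)
  have "card ((\<lambda>(b, c, z). (b, K c z)) ` ?S) \<le> card ?S" by (rule card_image_le[OF fS])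
  also have "\<dots> = (\<Sum>b<N. card ({..<q} \<times> spread F l ((d + b) mod m)))"
    using s by (intro card_SigmaI) auto
  also have "\<dots> \<le> (\<Sum>b<N. q * 29 ^ l)"
    using card_spread_le[OF F] m by (intro sum_mono) (simp add: card_cartesian_product)
  finally show "card ((\<lambda>(b, c, z). (b, K c z)) ` ?S) \<le> N * (q * 29 ^ l)" by simp
qed

text \<open>If \<open>R - card T\<close> is at most \<open>2 * R / 5\<close>, the labels of the
  missed edges see enough columns: each label has two private columns of the first kind, while among
  the only \<open>R\<close> columns of the second kind an expander does the doubling. For smaller
  \<open>T\<close> the dispersed edges are used.\<close>

lemma sparse_adjacency:
  fixes H :: "nat set set"
  assumes H: "crit R H" and disp: "dispersed q R H"
    and R: "R \<ge> 17" and q: "q \<ge> 76" and n: "2 * R \<le> n" "3 * (n + R) \<le> (q + 3) * R"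
  obtains adj1 adj2 where
    "\<And>T S1 S2. finite T \<Longrightarrow> S1 \<subseteq> {..<n} \<Longrightarrow> S2 \<subseteq> {..<R} \<Longrightarrow>
      card T + card S1 + card S2 < n + R \<Longrightarrow>
      card S1 + 2 * card T + 2 \<le> 2 * R \<or> card S2 + 2 * card T + 2 \<le> 2 * R \<Longrightarrow>
      \<exists>h\<in>H. T \<inter> h = {} \<and> ((\<exists>b<n. b \<notin> S1 \<and> adj1 b h) \<or> (\<exists>i<R. i \<notin> S2 \<and> adj2 i h))"
    "card {(b, h). b < n \<and> h \<in> H \<and> adj1 b h} + card {(i, h). i < R \<and> h \<in> H \<and> adj2 i h}
      \<le> 31 * card H + (n + R) * (q * 29 ^ q)"
proof -
  obtain m K where m: "q * R \<le> (q + 4) * m" and K: "\<And>c z. c < q \<Longrightarrow> z < m \<Longrightarrow> K c z \<in> H"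
    and Kx: "\<And>x. card {(c, z). c < q \<and> z < m \<and> x \<in> K c z} \<le> q"
    using disp unfolding dispersed_def by blast
  \<comment> \<open>The room required by \<open>spread_mod_expands\<close> when
    \<open>5 * card T < 3 * R\<close>. For \<open>q \<ge> 76\<close> one has
    \<open>m \<ge> 19/20 * R\<close>, and \<open>R \<ge> 17\<close> absorbs the constant.\<close>
  have m1: "3 * R + 13 \<le> 4 * m"
  proof (rule ccontr)
    assume "\<not> ?thesis"
    then have "4 * m \<le> 3 * R + 12" by simp
    then have "(q + 4) * (4 * m) \<le> (q + 4) * (3 * R + 12)" by (rule mult_le_mono2)
    then have "4 * (q * R) \<le> (q + 4) * (3 * R + 12)" using m by linarith
    moreover obtain a b where "q = 76 + a" "R = 17 + b" using q R le_Suc_ex by metis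
    ultimately show False by (simp add: algebra_simps)
  qed
  have m2: "n + R \<le> q * m"
  proof (rule ccontr)
    assume "\<not> ?thesis"
    then have "3 * (q * m) < 3 * (n + R)" by simp
    then have "3 * (q * m) < (q + 3) * R" using n(2) by (rule less_le_trans)
    then have "q * (3 * (q * m)) < q * ((q + 3) * R)" using q by simp
    also have "\<dots> = (q + 3) * (q * R)" by simp
    also have "\<dots> \<le> (q + 3) * ((q + 4) * m)" using m by (rule mult_le_mono2)
    finally have lt: "q * (3 * (q * m)) < (q + 3) * ((q + 4) * m)" .
    obtain a where "q = 76 + a" using q le_Suc_ex by metis
    then have "(q + 3) * (q + 4) \<le> 3 * (q * q)" by (simp add: algebra_simps)
    then have "((q + 3) * (q + 4)) * m \<le> (3 * (q * q)) * m" by (rule mult_le_mono1)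
    then show False using lt by (simp add: mult_ac)
  qed
  have m0: "m > 0" using m1 by simp
  obtain lab where lab: "\<And>h. h \<in> H \<Longrightarrow> lab h < R"
    and missed: "\<And>T. finite T \<Longrightarrow> R \<le> card T + card (lab ` {h \<in> H. T \<inter> h = {}})"
    using missed_labels[OF H] R by auto
  obtain F where F: "doubling R F" by (rule doubling_exists)
  obtain F' where F': "doubling m F'" by (rule doubling_exists)
  \<comment> \<open>All \<open>n + R\<close> columns are numbered consecutively, the second kind
    after the first. Column \<open>s\<close> is joined to every \<open>K c z\<close> with
    \<open>z\<close> reached in \<open>q\<close> steps from \<open>s mod m\<close>.\<close>
  define X where "X s = spread F' q (s mod m)" for s
  define adj1 where "adj1 b h \<longleftrightarrow> b div 2 = lab h \<or> (\<exists>c<q. \<exists>z\<in>X (0 + b). h = K c z)" for b h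
  define adj2 where "adj2 i h \<longleftrightarrow> i \<in> F (lab h) \<or> (\<exists>c<q. \<exists>z\<in>X (n + i). h = K c z)" for i h
  have Xm: "X s \<subseteq> {..<m}" for s
    unfolding X_def using spread_subset[OF F'] m0 by simp
  have finH: "finite H" using crit_finite[OF H] by simp
  show thesis
  proof (rule that[of adj1 adj2])
    fix T :: "nat set" and S1 S2 :: "nat set"
    assume T: "finite T" and S: "S1 \<subseteq> {..<n}" "S2 \<subseteq> {..<R}"
      and sum: "card T + card S1 + card S2 < n + R"
      and few: "card S1 + 2 * card T + 2 \<le> 2 * R \<or> card S2 + 2 * card T + 2 \<le> 2 * R"
    have fS: "finite S1" "finite S2" using S finite_subset by auto
    define U where "U = {h \<in> H. T \<inter> h = {}}"
    show "\<exists>h\<in>H. T \<inter> h = {} \<and> ((\<exists>b<n. b \<notin> S1 \<and> adj1 b h) \<or> (\<exists>i<R. i \<notin> S2 \<and> adj2 i h))"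
    proof (cases "5 * (R - card T) \<le> 2 * R")
      case True
      have "R - card T \<le> card (lab ` U)" using missed[OF T] unfolding U_def by linarith
      then obtain L where L: "L \<subseteq> lab ` U" "card L = R - card T"
        by (rule obtain_subset_with_card_n)
      have LR: "L \<subseteq> {..<R}" using L(1) lab by (auto simp: U_def)
      from few show ?thesis
      proof
        assume few1: "card S1 + 2 * card T + 2 \<le> 2 * R"
        let ?N = "{b. b div 2 \<in> L}"
        have "?N \<subseteq> {..<n}"
        proof
          fix b assume "b \<in> ?N"
          then have "b div 2 < R" using LR by blast
          then have "b < n" using n(1) by linarith
          then show "b \<in> {..<n}" by simp
        qed
        then have fN: "finite ?N" by (rule finite_subset) simp
        have "card (L \<times> {..<2::nat}) \<le> card ?N"
        proof (rule card_inj_on_le[OF _ _ fN])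
          show "inj_on (\<lambda>(z, e). 2 * z + e) (L \<times> {..<2})" by (auto intro!: inj_onI) presburger+
        qed auto
        then have "card S1 < card ?N" using few1 L(2) by (simp add: card_cartesian_product)
        then have "\<not> ?N \<subseteq> S1" using card_mono[OF fS(1)] by (meson not_le)
        then obtain b where b: "b div 2 \<in> L" "b \<notin> S1" by blast
        then obtain h where "h \<in> U" "b div 2 = lab h" using L(1) by blast
        moreover have "b < n" using \<open>?N \<subseteq> {..<n}\<close> b by blast
        ultimately show ?thesis using b unfolding U_def adj1_def by blast
      next
        assume few2: "card S2 + 2 * card T + 2 \<le> 2 * R"
        have "2 * card L \<le> card (\<Union>z\<in>L. F z)"
          using doubling_expands[OF F LR] True L(2) by simp
        then have "card S2 < card (\<Union>z\<in>L. F z)" using few2 L(2) by simp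
        then have "\<not> (\<Union>z\<in>L. F z) \<subseteq> S2" using card_mono[OF fS(2)] by (meson not_le)
        then obtain i z where i: "z \<in> L" "i \<in> F z" "i \<notin> S2" by blast
        then obtain h where "h \<in> U" "z = lab h" using L(1) by blast
        moreover have "i < R" using i doubling_subset[OF F LR] by blast
        ultimately show ?thesis using i unfolding U_def adj2_def by blast
      qed
    next
      case False
      \<comment> \<open>The columns outside \<open>S1\<close> and \<open>S2\<close>. By
        \<open>sum\<close> there are more than \<open>card T\<close> of them, so they expand to more
        than \<open>card T\<close> values of \<open>z\<close>, one of which gives a missed
        edge.\<close>
      define S where "S = {..<n + R} - (S1 \<union> (+) n ` S2)"
      have "card T + 1 \<le> card S"
      proof -
        have "card (S1 \<union> (+) n ` S2) \<le> card S1 + card S2"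
          using card_Un_le[of S1 "(+) n ` S2"] card_image_le[OF fS(2), of "(+) n"] by linarith
        moreover have "card {..<n + R} - card (S1 \<union> (+) n ` S2) \<le> card S"
          unfolding S_def using fS by (intro diff_card_le_card_Diff) simp
        ultimately show ?thesis using sum by simp
      qed
      then obtain S0 where S0: "S0 \<subseteq> S" "card S0 = card T + 1"
        by (rule obtain_subset_with_card_n)
      define Z where "Z = (\<Union>s\<in>S0. X s)"
      have "card S0 \<le> card Z" unfolding Z_def X_def
      proof (rule spread_mod_expands[OF F'])
        show "S0 \<subseteq> {..<q * m}" using S0(1) m2 by (auto simp: S_def)
        show "5 * card S0 + 8 \<le> 4 * m" using False S0(2) m1 by simp
      qed
      have Zm: "Z \<subseteq> {..<m}" using Xm by (auto simp: Z_def)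
      have "\<exists>c z. c < q \<and> z \<in> Z \<and> T \<inter> K c z = {}"
      proof (rule ccontr)
        assume neg: "\<not> ?thesis"
        have "{..<q} \<times> Z \<subseteq> (\<Union>x\<in>T. {(c, z). c < q \<and> z < m \<and> x \<in> K c z})"
          using neg Zm by blast
        moreover have "finite {(c, z). c < q \<and> z < m \<and> x \<in> K c z}" for x
          by (rule finite_subset[of _ "{..<q} \<times> {..<m}"]) auto
        ultimately have "card ({..<q} \<times> Z) \<le> card (\<Union>x\<in>T. {(c, z). c < q \<and> z < m \<and> x \<in> K c z})"
          using T by (intro card_mono) auto
        also have "\<dots> \<le> (\<Sum>x\<in>T. card {(c, z). c < q \<and> z < m \<and> x \<in> K c z})"
          by (rule card_UN_le[OF T])
        also have "\<dots> \<le> (\<Sum>x\<in>T. q)" using Kx by (intro sum_mono)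
        finally have "q * card Z \<le> q * card T" by (simp add: card_cartesian_product mult.commute)
        then show False using \<open>card S0 \<le> card Z\<close> S0(2) q by simp
      qed
      then obtain c z where cz: "c < q" "z \<in> Z" "T \<inter> K c z = {}" by blast
      then have KH: "K c z \<in> H" using K Zm by blast
      obtain s where s: "s \<in> S" "z \<in> X s" using cz(2) S0(1) by (auto simp: Z_def)
      show ?thesis
      proof (cases "s < n")
        case True
        have "s \<notin> S1" using s by (simp add: S_def)
        moreover have "adj1 s (K c z)" unfolding adj1_def using cz(1) s(2) by auto
        ultimately show ?thesis using True KH cz(3) by blast
      next
        case False
        define i where "i = s - n"
        have i: "s = n + i" "i < R" using False s by (auto simp: i_def S_def)
        then have "i \<notin> S2" using s(1) by (auto simp: S_def)
        moreover have "adj2 i (K c z)" unfolding adj2_def using cz(1) s(2) i(1) by auto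
        ultimately show ?thesis using i(2) KH cz(3) by blast
      qed
    qed
  next
    \<comment> \<open>Through its label an edge of \<open>H\<close> gets 2 columns of the first kind
      and at most 29 of the second, together 31. \<open>W\<close> collects the pairs from dispersed
      edges, at most \<open>q * 29 ^ q\<close> per column.\<close>
    define W where "W N d = (\<lambda>(b, c, z). (b, K c z)) ` (SIGMA b:{..<N::nat}. {..<q} \<times> spread F' q ((d + b) mod m))" for N d
    have W: "finite (W N d)" "card (W N d) \<le> N * (q * 29 ^ q)" for N d
      unfolding W_def using card_spread_pairs[OF F' m0] by auto
    have "{(b, h). b < n \<and> h \<in> H \<and> adj1 b h} \<subseteq> (\<lambda>(h, e). (2 * lab h + e, h)) ` (H \<times> {..<2}) \<union> W n 0"
    proof clarify
      fix b h assume *: "b < n" "h \<in> H" "adj1 b h" "(b, h) \<notin> W n 0"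
      have "b div 2 = lab h"
      proof (rule ccontr)
        assume "b div 2 \<noteq> lab h"
        then obtain c z where "c < q" "z \<in> X (0 + b)" "h = K c z" using *(3) unfolding adj1_def by blast
        then have "(b, h) \<in> W n 0" unfolding W_def X_def using *(1)
          by (intro image_eqI[where x = "(b, c, z)"]) auto
        then show False using *(4) by simp
      qed
      then have "(b, h) = (case (h, b mod 2) of (h, e) \<Rightarrow> (2 * lab h + e, h))"
        by simp (metis mult_div_mod_eq)
      then show "(b, h) \<in> (\<lambda>(h, e). (2 * lab h + e, h)) ` (H \<times> {..<2})"
        using *(2) by (intro image_eqI[where x = "(h, b mod 2)"]) auto
    qed
    then have "card {(b, h). b < n \<and> h \<in> H \<and> adj1 b h} \<le> card ((\<lambda>(h, e). (2 * lab h + e, h)) ` (H \<times> {..<2}) \<union> W n 0)"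
      using finH W by (intro card_mono) auto
    also have "\<dots> \<le> card ((\<lambda>(h, e). (2 * lab h + e, h)) ` (H \<times> {..<2::nat})) + card (W n 0)"
      by (rule card_Un_le)
    also have "\<dots> \<le> card (H \<times> {..<2::nat}) + n * (q * 29 ^ q)"
      using finH W by (intro add_mono card_image_le) auto
    finally have 1: "card {(b, h). b < n \<and> h \<in> H \<and> adj1 b h} \<le> 2 * card H + n * (q * 29 ^ q)"
      by (simp add: card_cartesian_product)
    have FL: "finite (F (lab h))" "card (F (lab h)) \<le> 29" if "h \<in> H" for h
      using F lab[OF that] by (auto simp: doubling_def intro: finite_subset)
    have fS: "finite (SIGMA h:H. F (lab h))" using finH FL by auto
    have "{(i, h). i < R \<and> h \<in> H \<and> adj2 i h} \<subseteq> prod.swap ` (SIGMA h:H. F (lab h)) \<union> W R n"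
    proof clarify
      fix i h assume *: "i < R" "h \<in> H" "adj2 i h" "(i, h) \<notin> W R n"
      have "i \<in> F (lab h)"
      proof (rule ccontr)
        assume "i \<notin> F (lab h)"
        then obtain c z where "c < q" "z \<in> X (n + i)" "h = K c z" using *(3) unfolding adj2_def by blast
        then have "(i, h) \<in> W R n" unfolding W_def X_def using *(1)
          by (intro image_eqI[where x = "(i, c, z)"]) auto
        then show False using *(4) by simp
      qed
      then show "(i, h) \<in> prod.swap ` (SIGMA h:H. F (lab h))"
        using *(2) by (intro image_eqI[where x = "(h, i)"]) auto
    qed
    then have "card {(i, h). i < R \<and> h \<in> H \<and> adj2 i h} \<le> card (prod.swap ` (SIGMA h:H. F (lab h)) \<union> W R n)"
      using fS W by (intro card_mono) auto
    also have "\<dots> \<le> card (prod.swap ` (SIGMA h:H. F (lab h))) + card (W R n)"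
      by (rule card_Un_le)
    also have "\<dots> \<le> card (SIGMA h:H. F (lab h)) + R * (q * 29 ^ q)"
      using fS W by (intro add_mono card_image_le) auto
    also have "card (SIGMA h:H. F (lab h)) = (\<Sum>h\<in>H. card (F (lab h)))"
      using finH FL by (intro card_SigmaI) auto
    also have "\<dots> \<le> (\<Sum>h\<in>H. 29)" using FL by (intro sum_mono)
    finally have "card {(i, h). i < R \<and> h \<in> H \<and> adj2 i h} \<le> 29 * card H + R * (q * 29 ^ q)"
      by simp
    then show "card {(b, h). b < n \<and> h \<in> H \<and> adj1 b h} + card {(i, h). i < R \<and> h \<in> H \<and> adj2 i h}
        \<le> 31 * card H + (n + R) * (q * 29 ^ q)"
      using 1 by (simp add: add_mult_distrib)
  qed
qed

text \<open>Serves the levels where \<open>R\<close> is bounded and \<open>H\<close> is a complete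
  hypergraph without known dispersion: there joining every column to every edge is
  affordable.\<close>

lemma complete_adjacency:
  fixes H :: "nat set set"
  assumes H: "crit R H" and T: "finite T" and S: "S1 \<subseteq> {..<n}" "S2 \<subseteq> {..<R}"
    and sum: "card T + card S1 + card S2 < n + R" and few: "card T < R"
    and adj: "\<And>k h. adj1 k h" "\<And>k h. adj2 k h"
  shows "\<exists>h\<in>H. T \<inter> h = {} \<and> ((\<exists>b<n. b \<notin> S1 \<and> adj1 b h) \<or> (\<exists>i<R. i \<notin> S2 \<and> adj2 i h))"
proof -
  obtain h where h: "h \<in> H" "T \<inter> h = {}" using crit_missed[OF H T few] .
  have "(\<exists>b<n. b \<notin> S1) \<or> (\<exists>i<R. i \<notin> S2)"
  proof (rule ccontr)
    assume "\<not> ?thesis"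
    then have "S1 = {..<n}" "S2 = {..<R}" using S by auto
    then show False using sum by simp
  qed
  then show ?thesis using h adj by blast
qed

text \<open>The residue makes \<open>n1\<close> coprime to every positive \<open>d < q\<close>, and
  primality of \<open>q\<close> extends this to \<open>q * n1\<close>; lines modulo
  \<open>n1\<close> serve inside a class, lines modulo \<open>q * n1\<close> between classes.
  \<open>R \<ge> 3 * n1\<close> leaves room for all partitions, and \<open>R \<le> 4 * n1\<close>
  yields dispersion.\<close>

lemma recursion_step:
  fixes H :: "nat set set" and q n1 R :: nat
  assumes q: "prime q" "q \<ge> 76" and n1: "n1 mod fact q = 1" and R: "3 * n1 \<le> R" "R \<le> 4 * n1"
    and H: "crit R H"
    and adj: "\<And>T S1 S2. finite T \<Longrightarrow> S1 \<subseteq> {..<q * n1} \<Longrightarrow> S2 \<subseteq> {..<R} \<Longrightarrow>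
      card T + card S1 + card S2 < q * n1 + R \<Longrightarrow>
      card S1 + 2 * card T + 2 \<le> 2 * R \<or> card S2 + 2 * card T + 2 \<le> 2 * R \<Longrightarrow>
      \<exists>h\<in>H. T \<inter> h = {} \<and> ((\<exists>b<q * n1. b \<notin> S1 \<and> adj1 b h) \<or> (\<exists>i<R. i \<notin> S2 \<and> adj2 i h))"
  obtains E :: "nat set set" where "crit (q * n1 + R) E" "dispersed q (q * n1 + R) E"
    "card E \<le> 58 * q * (q * n1) + card {(b, h). b < q * n1 \<and> h \<in> H \<and> adj1 b h}
      + card {(i, h). i < R \<and> h \<in> H \<and> adj2 i h}"
proof -
  have n1_pos: "n1 > 0" using n1 by (cases n1) auto
  have "odd q" using q prime_odd_nat by simp
  then obtain h where h: "q = 2 * h + 1" by (rule oddE)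
  have cop1: "coprime d n1" if "0 < d" "d < q" for d
  proof -
    have "[n1 = 1] (mod fact q)" using n1 mod_mod_trivial[of n1 "fact q"] by (simp add: cong_def)
    from cong_imp_coprime[OF cong_sym[OF this]] have "coprime (fact q) n1"
      by (simp add: coprime_commute)
    moreover have "d dvd fact q" using that by (simp add: dvd_fact)
    ultimately show ?thesis by (meson coprime_divisors dvd_refl)
  qed
  have cop: "coprime d (q * n1)" if d: "0 < d" "d < q" for d
  proof -
    have "\<not> q dvd d" using d by (auto dest: dvd_imp_le)
    from prime_imp_coprime[OF q(1) this] have "coprime d q" by (simp add: coprime_commute)
    then show ?thesis using cop1[OF d] by simp
  qed
  obtain \<rho> :: "nat \<Rightarrow> nat \<Rightarrow> nat \<Rightarrow> nat" where
    \<rho>: "\<And>i c y. c < q \<Longrightarrow> y < q * n1 \<Longrightarrow> \<rho> i c y < q * n1"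
    "\<And>i a. card {(c, y). c < q \<and> y < q * n1 \<and> \<rho> i c y = a} \<le> q"
    "\<And>c y y'. c < q \<Longrightarrow> y < q * n1 \<Longrightarrow> y' < q * n1 \<Longrightarrow> \<exists>i<R. \<rho> i c y = \<rho> i c y'"
    by (rule resolvable_pair_cover[OF h _ n1_pos R(1) cop1]) (use h q in auto)
  obtain F where F: "doubling (q * n1) F" by (rule doubling_exists)
  have Rn: "q * n1 + R \<le> (q + 4) * n1" using R(2) by (simp add: add_mult_distrib)
  interpret column_scheme "q * n1" q R F "\<lambda>b c z. (z + c * b) mod (q * n1)" \<rho> H adj1 adj2
  proof
    have "76 * 1 \<le> q * n1" using q n1_pos by (intro mult_le_mono) auto
    then show "8 \<le> q * n1" by simp
    show "\<exists>b<q * n1. (z + c * b) mod (q * n1) = (z' + c' * b) mod (q * n1)"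
      if "c < q" "c' < q" "c \<noteq> c'" for c c' z z'
      using lines_meet[OF _ cop that] q n1_pos by simp
  qed (use q n1_pos R F \<rho> H adj inj_on_shift_mod in auto)
  \<comment> \<open>Triples are renamed to natural numbers so that the result can serve as
    \<open>H\<close> one level up.\<close>
  obtain f :: "nat \<times> nat \<times> nat \<Rightarrow> nat" where f: "inj_on f (\<Union>edges)"
    using finite_imp_inj_to_nat_seg[OF crit_finite(2)[OF crit_edges]] by blast
  \<comment> \<open>Witnessed by the diagonal rows, with \<open>m = q * n1\<close>.\<close>
  have disp: "dispersed q (q * n1 + R) edges" unfolding dispersed_def
  proof (intro exI conjI allI impI)
    have "q * (q * n1 + R) \<le> q * ((q + 4) * n1)" using Rn by (rule mult_le_mono2)
    then show "q * (q * n1 + R) \<le> (q + 4) * (q * n1)" by (simp add: algebra_simps)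
  qed (use diagonal_row_edge card_diagonal_rows in auto)
  have "card ((`) f ` edges) \<le> card edges" using finite_edges by (rule card_image_le)
  then show thesis
    using that[OF crit_image[OF crit_edges f] dispersed_image[OF disp f]] card_edges by simp
qed

text \<open>\<open>n1 = Q * t + 1\<close> has to lie between \<open>r / (q + 4)\<close> and
  \<open>r / (q + 3)\<close>, an interval of length at least \<open>Q\<close> by the assumption on
  \<open>r\<close>. For \<open>R = r - q * n1\<close> this says
  \<open>3 * n1 \<le> R \<le> 4 * n1\<close>.\<close>

lemma choose_modulus:
  fixes q Q r :: nat
  assumes Q: "Q > 0" and r: "(q + 3) * ((q + 4) * Q) \<le> r"
  obtains t where "(q + 3) * (Q * t + 1) \<le> r" "r \<le> (q + 4) * (Q * t + 1)"
proof -
  define k where "k = r div (q + 3)"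
  define t where "t = (k - 1) div Q"
  have k: "(q + 4) * Q \<le> k" using r unfolding k_def by (metis div_le_mono nonzero_mult_div_cancel_left add_is_0 zero_neq_numeral)
  have kr: "(q + 3) * k \<le> r" "r \<le> (q + 3) * (k + 1)"
    unfolding k_def using times_div_less_eq_dividend[of "q + 3" r] dividend_less_times_div[of "q + 3" r]
    by (simp_all add: algebra_simps)
  have k1: "k \<ge> 1" using k Q by (cases k) auto
  have t: "Q * t \<le> k - 1" "k - 1 < Q * t + Q"
    unfolding t_def using Q times_div_less_eq_dividend[of Q "k - 1"] dividend_less_times_div[of Q "k - 1"] by simp_all
  show thesis
  proof
    have "(q + 3) * (Q * t + 1) \<le> (q + 3) * k" using t k1 by (intro mult_le_mono2) simp
    then show "(q + 3) * (Q * t + 1) \<le> r" using kr by linarith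
    have "(q + 3) * (k + 1) \<le> (q + 3) * (Q * t + 1 + Q)" using t k1 by (intro mult_le_mono2) simp
    also have "\<dots> = (q + 3) * (Q * t + 1) + (q + 3) * Q" by (simp add: algebra_simps)
    also have "(q + 3) * Q \<le> Q * t + 1"
      using k t k1 by (simp add: algebra_simps)
    finally have "(q + 3) * (k + 1) \<le> (q + 4) * (Q * t + 1)" by (simp add: algebra_simps)
    then show "r \<le> (q + 4) * (Q * t + 1)" using kr(2) by linarith
  qed
qed

lemma linear_critical:
  obtains C :: nat where "C > 0"
    "\<And>r. r > 0 \<Longrightarrow> \<exists>E :: nat set set. crit r E \<and> card E \<le> C * r"
proof -
  \<comment> \<open>With \<open>R \<le> 4 * n1\<close>, the bound \<open>q \<ge> 250\<close> ensures
    \<open>61 * R \<le> q * n1\<close>, that is \<open>62 * R \<le> r\<close>.\<close>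
  obtain q :: nat where q: "prime q" "q \<ge> 250" using bigger_prime[of 250] by (auto simp: less_imp_le)
  define Q :: nat where "Q = fact q"
  have Q: "Q > 1" using q unfolding Q_def by (metis fact_ge_self le_trans less_le_trans numeral_less_iff one_less_numeral_iff semiring_norm(76) zero_less_numeral leD not_le)
  define r0 where "r0 = (q + 3) * ((q + 4) * Q)"
  define D where "D = 58 * q + q * 29 ^ q"
  \<comment> \<open>\<open>2 * D\<close> pays for \<open>card E \<le> D * r + 31 * card H\<close>,
    where \<open>62 * R \<le> r\<close> keeps the second term below half of \<open>C * r\<close>;
    \<open>4 ^ r0\<close> pays for the complete hypergraphs below \<open>r0\<close>.\<close>
  define C where "C = 2 * D + 4 ^ r0"
  have "17 * 1 \<le> (q + 3) * ((q + 4) * Q)" using q Q by (intro mult_le_mono) simp_all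
  then have r0: "r0 \<ge> 17" by (simp add: r0_def)
  have main: "\<exists>E :: nat set set. crit r E \<and> card E \<le> C * r \<and> (r \<ge> r0 \<longrightarrow> dispersed q r E)" if "r > 0" for r
    using that
  proof (induction r rule: less_induct)
    case (less r)
    show ?case
    proof (cases "r < r0")
      case True
      have "card {e. e \<subseteq> {..<2*r-1} \<and> card e = r} \<le> 4 ^ r" by (rule card_complete_le)
      also have "\<dots> \<le> 4 ^ r0" using True by (intro power_increasing) auto
      also have "\<dots> \<le> C * 1" by (simp add: C_def)
      also have "\<dots> \<le> C * r" using less.prems by (intro mult_le_mono2) simp
      finally show ?thesis using crit_complete[OF less.prems] True
        by (intro exI[of _ "{e. e \<subseteq> {..<2*r-1} \<and> card e = r}"]) simp
    next
      case False
      then obtain t where t: "(q + 3) * (Q * t + 1) \<le> r" "r \<le> (q + 4) * (Q * t + 1)"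
        using choose_modulus[of Q q r] Q unfolding r0_def by (metis not_less zero_less_one less_trans)
      define n1 where "n1 = Q * t + 1"
      define R where "R = r - q * n1"
      have "n1 mod Q = 1" using Q by (simp add: n1_def mod_Suc)
      then have n1: "n1 > 0" "n1 mod fact q = 1" by (simp_all add: n1_def Q_def)
      have r: "r = q * n1 + R" "3 * n1 \<le> R" "R \<le> 4 * n1"
        using t unfolding n1_def[symmetric] R_def by (auto simp: algebra_simps)
      have R: "R > 0" "R < r" using r n1 q by auto
      have qn: "250 * n1 \<le> q * n1" using q by (intro mult_le_mono1)
      have q76: "q \<ge> 76" using q by simp
      show ?thesis
      proof (cases "R < r0")
        case True
        define H where "H = {e. e \<subseteq> {..<2*R-1} \<and> card e = R}"
        have H: "crit R H" unfolding H_def by (rule crit_complete[OF R(1)])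
        have "card H \<le> 4 ^ R" unfolding H_def by (rule card_complete_le)
        also have "\<dots> \<le> 4 ^ r0" using True by (intro power_increasing) auto
        finally have cH: "card H \<le> 4 ^ r0" .
        obtain E :: "nat set set" where E: "crit (q * n1 + R) E" "dispersed q (q * n1 + R) E"
          "card E \<le> 58 * q * (q * n1) + card {(b, h). b < q * n1 \<and> h \<in> H \<and> True}
            + card {(i, h). i < R \<and> h \<in> H \<and> True}"
          by (rule recursion_step[OF q(1) q76 n1(2) r(2,3) H complete_adjacency[OF H]]) auto
        have "card {(b, h). b < N \<and> h \<in> H \<and> True} = N * card H" for N :: nat
        proof -
          have "{(b, h). b < N \<and> h \<in> H \<and> True} = {..<N} \<times> H" by auto
          then show ?thesis by (simp add: card_cartesian_product)
        qed
        then have "card E \<le> 58 * q * (q * n1) + (q * n1 + R) * card H"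
          using E(3) by (simp add: algebra_simps)
        also have "\<dots> \<le> 58 * q * r + r * 4 ^ r0"
          using r(1) cH by (intro add_mono mult_le_mono) auto
        also have "\<dots> \<le> C * r" unfolding C_def D_def by (simp add: algebra_simps)
        finally show ?thesis using E r(1) by auto
      next
        case False
        obtain H :: "nat set set" where H: "crit R H" "card H \<le> C * R" "dispersed q R H"
          using less.IH[OF R(2,1)] False by auto
        have R2: "2 * R \<le> q * n1" using r qn by linarith
        have R3: "3 * (q * n1 + R) \<le> (q + 3) * R"
        proof -
          have "q * (3 * n1) \<le> q * R" using r(2) by (rule mult_le_mono2)
          then show ?thesis by (simp add: algebra_simps)
        qed
        have R17: "17 \<le> R" using False r0 by simp
        obtain adj1 adj2 where adj:
          "\<And>T S1 S2. finite T \<Longrightarrow> S1 \<subseteq> {..<q * n1} \<Longrightarrow> S2 \<subseteq> {..<R} \<Longrightarrow>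
            card T + card S1 + card S2 < q * n1 + R \<Longrightarrow>
            card S1 + 2 * card T + 2 \<le> 2 * R \<or> card S2 + 2 * card T + 2 \<le> 2 * R \<Longrightarrow>
            \<exists>h\<in>H. T \<inter> h = {} \<and> ((\<exists>b<q * n1. b \<notin> S1 \<and> adj1 b h) \<or> (\<exists>i<R. i \<notin> S2 \<and> adj2 i h))"
          and c: "card {(b, h). b < q * n1 \<and> h \<in> H \<and> adj1 b h} + card {(i, h). i < R \<and> h \<in> H \<and> adj2 i h}
            \<le> 31 * card H + (q * n1 + R) * (q * 29 ^ q)"
          by (rule sparse_adjacency[OF H(1,3) R17 q76 R2 R3]) blast
        obtain E :: "nat set set" where E: "crit (q * n1 + R) E" "dispersed q (q * n1 + R) E"
          "card E \<le> 58 * q * (q * n1) + card {(b, h). b < q * n1 \<and> h \<in> H \<and> adj1 b h}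
            + card {(i, h). i < R \<and> h \<in> H \<and> adj2 i h}"
          by (rule recursion_step[OF q(1) q76 n1(2) r(2,3) H(1) adj])
        have "2 * card E \<le> 2 * (58 * q * r) + 62 * card H + 2 * (r * (q * 29 ^ q))"
        proof -
          have "58 * q * (q * n1) \<le> 58 * q * r" using r(1) by (intro mult_le_mono2) simp
          then show ?thesis using E(3) c[folded r(1)] by linarith
        qed
        also have "\<dots> = 2 * D * r + 62 * card H" by (simp add: D_def algebra_simps)
        also have "62 * card H \<le> C * (62 * R)" using H(2) by simp
        also have "C * (62 * R) \<le> C * r" using r qn by (intro mult_le_mono2) linarith
        also have "2 * D * r \<le> C * r" by (simp add: C_def)
        finally have "card E \<le> C * r" by simp
        then show ?thesis using E r(1) by auto
      qed
    qed
  qed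
  show thesis
    by (rule that[of C]) (use main in \<open>auto simp: C_def\<close>)
qed

section \<open>Few vertices\<close>

lemma critical_on_nat:
  fixes E :: "'a set set"
  assumes "crit r E" "r > 0" "card (\<Union>E) \<le> n" "real (card E) \<le> B"
  shows "\<exists>(V :: nat set) (E :: nat set set). card V = n \<and> critical r V E \<and> real (card E) \<le> B"
proof -
  obtain E' :: "nat set set" where E': "crit r E'" "card E' \<le> card E" "\<Union>E' \<subseteq> {..<n}"
    using crit_transfer[OF assms(1,3)] .
  have "critical r {..<n} E'" using crit_imp_critical[OF E'(1) assms(2) _ E'(3)] by simp
  then show ?thesis using E'(2) assms(4) by (intro exI[of _ "{..<n}"] exI[of _ E']) simp
qed

lemma binomial_le_power_of_ratio:
  assumes "N \<le> 2 * r" "k \<le> t" "0 < t" "t \<le> r" "r \<le> t * m"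
  shows "real (N choose k) \<le> (6 * real m) ^ t"
proof -
  have "N choose k \<le> 2 * r choose k" using assms(1) by (rule binomial_right_mono)
  also have "\<dots> \<le> 2 * r choose t" using assms by (intro binomial_mono) auto
  finally have "real (N choose k) \<le> real (2 * r choose t)" by simp
  also have "\<dots> \<le> (3 * real (2 * r) / real t) ^ t" by (rule binomial_le_power_div[OF assms(3)])
  also have "\<dots> \<le> (6 * real m) ^ t"
  proof (rule power_mono)
    have "real r \<le> real t * real m" using assms(5) by (simp flip: of_nat_mult)
    then show "3 * real (2 * r) / real t \<le> 6 * real m" using assms(3) by (simp add: divide_simps mult.commute)
  qed simp
  finally show ?thesis .
qed

text \<open>With \<open>r = t * a + p\<close>, substitution of a linear-size
  \<open>a\<close>-uniform hypergraph reaches \<open>t * a\<close> and the extension adds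
  \<open>p\<close>. The edges number at most \<open>4 * (4 * C * m) ^ t * (6 * m) ^ t\<close>,
  whence the 96.\<close>

lemma composed_critical:
  fixes r m t C :: nat
  assumes lin: "\<And>s. s > 0 \<Longrightarrow> \<exists>G :: nat set set. crit s G \<and> card G \<le> C * s"
    and C: "C > 0" and t: "0 < t" "t \<le> r" "r \<le> t * m"
    and n: "(2 * C + 2) * r * m \<le> n" and B: "(96 * real C * (real m)\<^sup>2) ^ t \<le> B"
  shows "\<exists>(V :: nat set) (E :: nat set set). card V = n \<and> critical r V E \<and> real (card E) \<le> B"
proof -
  define a where "a = r div t"
  define p where "p = r mod t"
  have r: "r = t * a + p" "p < t" using t by (auto simp: a_def p_def)
  have a: "a > 0" using t by (simp add: a_def div_greater_zero_iff)
  have "t * a \<le> t * m" using r t(3) by linarith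
  then have am: "a \<le> m" using t(1) by simp
  then have m: "m > 0" using a by simp
  obtain G :: "nat set set" where G: "crit a G" "card G \<le> C * a" using lin[OF a] by blast
  define E where "E = (\<lambda>(S, \<phi>). Sigma S \<phi>) `
    (SIGMA S:{S. S \<subseteq> {..<2*t-1} \<and> card S = t}. PiE S (\<lambda>_. G))"
  have E: "crit (t * a) E" "card E \<le> 4 ^ t * card G ^ t" "\<Union>E \<subseteq> {..<2*t-1} \<times> \<Union>G"
    unfolding E_def by (rule crit_complete_composition[OF G(1) t(1)])+
  have "card (\<Union>E) \<le> card ({..<2*t-1} \<times> \<Union>G)"
    using E(3) crit_finite[OF G(1)] by (intro card_mono) auto
  also have "\<dots> = (2*t-1) * card (\<Union>G)" by (simp add: card_cartesian_product)
  also have "\<dots> \<le> (2 * t) * (a * (C * a))"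
    using crit_card_Union[OF G(1)] G(2) by (intro mult_le_mono) (auto intro: order_trans)
  also have "\<dots> = 2 * C * (t * a) * a" by (simp add: algebra_simps)
  also have "\<dots> \<le> 2 * C * r * m" using r am by (intro mult_le_mono) auto
  finally have vE: "card (\<Union>E) \<le> 2 * C * r * m" .
  have "real (card E) \<le> real (4 ^ t * card G ^ t)" using E(2) by (simp only: of_nat_le_iff)
  also have "\<dots> = (4 * real (card G)) ^ t" by (simp add: power_mult_distrib)
  also have "\<dots> \<le> (4 * (real C * real m)) ^ t"
  proof -
    have "card G \<le> C * m" using G(2) am by (meson mult_le_mono2 order_trans)
    then have "real (card G) \<le> real C * real m" by (simp flip: of_nat_mult)
    then show ?thesis by (intro power_mono) auto
  qed
  finally have cE: "real (card E) \<le> (4 * (real C * real m)) ^ t" .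
  have Cm1: "1 \<le> real C * real m" using C m by (metis One_nat_def Suc_leI mult_pos_pos nat_0_less_mult_iff of_nat_1 of_nat_le_iff of_nat_mult)
  have m1: "1 \<le> real m" using m by simp
  show ?thesis
  proof (cases "p = 0")
    case True
    have "2 * C * r * m \<le> n" using n by (simp add: algebra_simps)
    then have "card (\<Union>E) \<le> n" using vE by linarith
    moreover have "real (card E) \<le> B"
    proof -
      have "(4 * (real C * real m)) ^ t \<le> (96 * real C * (real m)\<^sup>2) ^ t"
      proof (rule power_mono)
        have "(real C * real m) * 1 \<le> (real C * real m) * real m" using m1 Cm1 by (intro mult_left_mono) auto
        then show "4 * (real C * real m) \<le> 96 * real C * (real m)\<^sup>2" using Cm1 by (simp add: power2_eq_square mult_ac)
      qed (use Cm1 in simp)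
      then show ?thesis using cE B by linarith
    qed
    ultimately show ?thesis using critical_on_nat[OF E(1)] r True a t(1) by simp
  next
    case False
    define E' :: "(nat \<times> nat + nat) set set" where "E' = (\<lambda>(g, S). Inl ` g \<union> Inr ` S) ` (E \<times> {S. S \<subseteq> {..<t * a + 2*p - 1} \<and> card S = p})
     \<union> (`) Inr ` {F. F \<subseteq> {..<t * a + 2*p - 1} \<and> card F = t * a + p}"
    define N where "N = t * a + 2 * p - 1"
    have p: "p > 0" using False by simp
    have E': "crit (t * a + p) E'" "card E' \<le> (card E + 1) * ((N choose p) + (N choose (t * a + p)))"
      "\<Union>E' \<subseteq> \<Union>E <+> {..<N}"
      using crit_extension[OF E(1) p] unfolding E'_def N_def by simp_all
    have N: "N \<le> 2 * r" using r t(2) unfolding N_def by linarith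
    have "card (\<Union>E') \<le> card (\<Union>E <+> {..<N})"
      using E'(3) crit_finite[OF E(1)] by (intro card_mono) auto
    also have "\<dots> = card (\<Union>E) + N" using crit_finite[OF E(1)] by (simp add: card_Plus)
    also have "\<dots> \<le> 2 * C * r * m + 2 * r * m"
    proof -
      have "2 * r * 1 \<le> 2 * r * m" using m by (intro mult_le_mono2) simp
      then show ?thesis using vE N by linarith
    qed
    also have "\<dots> \<le> n" using n by (simp add: algebra_simps)
    finally have v: "card (\<Union>E') \<le> n" .
    \<comment> \<open>After this reflection both binomials have lower index at most
      \<open>t\<close>.\<close>
    have "N choose (t * a + p) = N choose (p - 1)"
      using p by (subst binomial_symmetric) (auto simp: N_def)
    then have "real (card E') \<le> real (card E + 1) * (real (N choose p) + real (N choose (p - 1)))"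
      using E'(2) by (metis of_nat_add of_nat_le_iff of_nat_mult)
    also have "\<dots> \<le> (2 * (4 * (real C * real m)) ^ t) * ((6 * real m) ^ t + (6 * real m) ^ t)"
    proof (intro mult_mono add_mono)
      have "1 \<le> (4 * (real C * real m)) ^ t" using Cm1 by (intro one_le_power) simp
      then show "real (card E + 1) \<le> 2 * (4 * (real C * real m)) ^ t" using cE by simp
      show "real (N choose p) \<le> (6 * real m) ^ t"
        by (rule binomial_le_power_of_ratio[OF N _ t]) (use r(2) in simp)
      show "real (N choose (p - 1)) \<le> (6 * real m) ^ t"
        by (rule binomial_le_power_of_ratio[OF N _ t]) (use r(2) in simp)
    qed (use Cm1 in auto)
    also have "\<dots> = 4 * ((4 * (real C * real m)) * (6 * real m)) ^ t"
      by (simp only: power_mult_distrib) simp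
    also have "\<dots> \<le> 4 ^ t * ((4 * (real C * real m)) * (6 * real m)) ^ t"
    proof (rule mult_right_mono)
      show "(4::real) \<le> 4 ^ t" using power_increasing[of 1 t "4::real"] t(1) by simp
    qed simp
    also have "\<dots> = (96 * real C * (real m)\<^sup>2) ^ t"
      by (simp flip: power_mult_distrib add: power2_eq_square mult_ac)
    finally have "real (card E') \<le> B" using B by linarith
    then show ?thesis using critical_on_nat[OF E'(1) _ v] r p by simp
  qed
qed

theorem theorem3p4:
  "\<exists>C::real. C > 0 \<and>
     (\<forall>n r :: nat. n \<ge> 2 * r - 1 \<and> 2 * r - 1 \<ge> 3 \<longrightarrow>
        (\<exists>(V :: nat set) (E :: nat set set).
           card V = n \<and> critical r V E \<and>
           real (card E) \<le> max ((real n / real r) powr (C * (real r)\<^sup>2 / real n)) (C * real r)))"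
proof -
  obtain C0 :: nat where C0: "C0 > 0"
    and lin: "\<And>s. s > 0 \<Longrightarrow> \<exists>G :: nat set set. crit s G \<and> card G \<le> C0 * s"
    by (rule linear_critical) blast
  \<comment> \<open>\<open>K * r * m\<close> vertices are what \<open>composed_critical\<close> asks
    for. The 16 in \<open>C\<close> arises from \<open>n \<le> 2 * K * r * m\<close> and
    \<open>m * t \<le> 2 * r\<close>, which give
    \<open>4 * t * n \<le> 16 * K * r^2\<close>.\<close>
  define K where "K = 2 * C0 + 2"
  define C where "C = 16 * real K"
  have K: "real K \<ge> 4" using C0 by (simp add: K_def)
  have "\<exists>(V :: nat set) (E :: nat set set). card V = n \<and> critical r V E \<and>
      real (card E) \<le> max ((real n / real r) powr (C * (real r)\<^sup>2 / real n)) (C * real r)"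
    if nr: "n \<ge> 2 * r - 1" "2 * r - 1 \<ge> 3" for n r :: nat
  proof -
    have r: "r \<ge> 2" using nr by simp
    have n: "n > 0" using nr by simp
    define x where "x = real n / real r"
    define B where "B = max (x powr (C * (real r)\<^sup>2 / real n)) (C * real r)"
    have x32: "3/2 \<le> x"
    proof -
      have "real n \<ge> 2 * real r - 1" using nr r by linarith
      then show ?thesis using r unfolding x_def by (simp add: pos_le_divide_eq)
    qed
    \<comment> \<open>The factor 4 in the exponent allows any base up to \<open>x ^ 4\<close>,
      enough for the base 4, as \<open>x \<ge> 3/2\<close>, and for a constant times
      \<open>m^2\<close>.\<close>
    have powB: "y ^ k \<le> B" if "0 \<le> y" "y \<le> x ^ 4" "4 * real k * real n \<le> C * (real r)\<^sup>2" for y k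
    proof -
      have "y ^ k \<le> (x ^ 4) ^ k" using that by (intro power_mono)
      also have "\<dots> = x ^ (4 * k)" by (simp add: power_mult)
      also have "\<dots> = x powr real (4 * k)" using x32 by (subst powr_realpow) auto
      also have "\<dots> \<le> x powr (C * (real r)\<^sup>2 / real n)"
        using x32 n that(3) by (intro powr_mono) (auto simp: pos_le_divide_eq)
      finally show ?thesis unfolding B_def by linarith
    qed
    \<comment> \<open>For \<open>n\<close> at least quadratic in \<open>r\<close> the linear-size
      hypergraph fits as it is; for \<open>n\<close> linear in \<open>r\<close> the complete one is
      small enough; in between the two are composed.\<close>
    consider "C0 * r\<^sup>2 \<le> n" | "n < K * r" | "K * r \<le> n" "n < C0 * r\<^sup>2" by linarith
    then show ?thesis unfolding x_def[symmetric] B_def[symmetric]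
    proof cases
      case 1
      obtain G :: "nat set set" where G: "crit r G" "card G \<le> C0 * r" using lin[of r] r by auto
      have "card (\<Union>G) \<le> r * (C0 * r)" using crit_card_Union[OF G(1)] G(2) by (meson mult_le_mono2 order_trans)
      then have v: "card (\<Union>G) \<le> n" using 1 by (simp add: power2_eq_square algebra_simps)
      have "real (card G) \<le> real C0 * real r" using G(2) by (simp flip: of_nat_mult)
      also have "\<dots> \<le> C * real r" by (intro mult_right_mono) (auto simp: C_def K_def)
      finally have "real (card G) \<le> B" unfolding B_def by linarith
      then show "\<exists>(V :: nat set) (E :: nat set set). card V = n \<and> critical r V E \<and> real (card E) \<le> B"
        using critical_on_nat[OF G(1) _ v] r by simp
    next
      case 2
      let ?E = "{e. e \<subseteq> {..<2*r-1} \<and> card e = r}"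
      have E: "crit r ?E" using r by (intro crit_complete) simp
      have "card (\<Union>?E) \<le> card {..<2*r-1}" by (intro card_mono) auto
      then have v: "card (\<Union>?E) \<le> n" using nr by simp
      have "real (card ?E) \<le> real (4 ^ r)" using card_complete_le[of r] by (simp only: of_nat_le_iff)
      also have "\<dots> = 4 ^ r" by simp
      also have "\<dots> \<le> B"
      proof (rule powB)
        have "(4::real) \<le> (3/2) ^ 4" by (simp add: power_divide)
        also have "\<dots> \<le> x ^ 4" using x32 by (intro power_mono) auto
        finally show "4 \<le> x ^ 4" .
        have "real n \<le> real K * real r" using 2 by (simp flip: of_nat_mult)
        then have "4 * real r * real n \<le> 4 * real r * (real K * real r)" by (intro mult_left_mono) auto
        also have "\<dots> \<le> C * (real r)\<^sup>2" unfolding C_def by (simp add: power2_eq_square algebra_simps)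
        finally show "4 * real r * real n \<le> C * (real r)\<^sup>2" .
      qed simp
      finally show "\<exists>(V :: nat set) (E :: nat set set). card V = n \<and> critical r V E \<and> real (card E) \<le> B"
        using critical_on_nat[OF E _ v] r by simp
    next
      case 3
      define m where "m = n div (K * r)"
      \<comment> \<open>The quotient \<open>r / m\<close> rounded up, so that pieces of uniformity
        \<open>r div t\<close> have size at most \<open>m\<close>.\<close>
      define t where "t = (r + m - 1) div m"
      have Kr: "K * r > 0" using r by (simp add: K_def)
      have m1: "m > 0" using 3(1) Kr by (simp add: m_def div_greater_zero_iff)
      have mn: "K * r * m \<le> n" "n < K * r * (m + 1)"
        unfolding m_def using times_div_less_eq_dividend[of "K * r" n] dividend_less_times_div[OF Kr, of n]
        by (simp_all add: algebra_simps)
      have "r * (K * m) \<le> n" using mn(1) by (simp add: mult_ac)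
      also have "n < r * (C0 * r)" using 3(2) by (simp add: power2_eq_square mult_ac)
      finally have "K * m < C0 * r" by simp
      moreover have "C0 * m \<le> K * m" by (simp add: K_def)
      ultimately have mr: "m < r" using C0 by (metis le_less_trans mult_less_cancel1)
      have tm: "r \<le> m * t" "m * t \<le> r + m - 1"
        unfolding t_def using m1 times_div_less_eq_dividend[of m "r + m - 1"] dividend_less_times_div[OF m1, of "r + m - 1"]
        by linarith+
      have t0: "0 < t" using tm r by (cases t) auto
      have tr: "t \<le> r"
      proof -
        have "m * t \<le> m * r"
        proof -
          obtain i j where "m = Suc i" "r = Suc j" using m1 r by (metis gr0_conv_Suc less_le_trans zero_less_numeral)
          then show ?thesis using tm(2) by simp
        qed
        then show ?thesis using m1 by simp
      qed
      have xm: "real K * real m \<le> x"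
        unfolding x_def using mn(1) r by (simp add: pos_le_divide_eq algebra_simps flip: of_nat_mult)
      have "(96 * real C0 * (real m)\<^sup>2) ^ t \<le> B"
      proof (rule powB)
        have x4: "4 \<le> x" using xm K m1 mult_mono[of 4 "real K" 1 "real m"] by simp
        have "8 * real C0 * (real m)\<^sup>2 \<le> (real K * real m)\<^sup>2"
          unfolding K_def by (simp add: power2_eq_square algebra_simps)
        also have "\<dots> \<le> x\<^sup>2" using xm by (intro power_mono) auto
        finally have "96 * real C0 * (real m)\<^sup>2 \<le> 12 * x\<^sup>2" by simp
        also have "\<dots> \<le> 4\<^sup>2 * x\<^sup>2" by simp
        also have "\<dots> \<le> x\<^sup>2 * x\<^sup>2" using x4 by (intro mult_right_mono power_mono) auto
        finally show "96 * real C0 * (real m)\<^sup>2 \<le> x ^ 4" by (simp flip: power_add)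
        have "real n \<le> real K * real r * (2 * real m)"
        proof -
          have "n \<le> K * r * (2 * m)" using mn(2) m1
            by (metis add_mono less_imp_le_nat mult_2 mult_le_mono2 nat_le_linear One_nat_def Suc_leI le_refl order_trans)
          then have "real n \<le> real (K * r * (2 * m))" by (simp only: of_nat_le_iff)
          then show ?thesis by simp
        qed
        then have "4 * real t * real n \<le> 4 * real t * (real K * real r * (2 * real m))"
          by (intro mult_left_mono) auto
        also have "\<dots> = 8 * real K * real r * real (m * t)" by simp
        also have "\<dots> \<le> 8 * real K * real r * real (2 * r)"
        proof (rule mult_left_mono)
          have "m * t \<le> 2 * r" using tm(2) mr by linarith
          then show "real (m * t) \<le> real (2 * r)" by (simp only: of_nat_le_iff)
        qed simp
        also have "\<dots> = C * (real r)\<^sup>2" by (simp add: C_def power2_eq_square)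
        finally show "4 * real t * real n \<le> C * (real r)\<^sup>2" .
      qed simp
      then show "\<exists>(V :: nat set) (E :: nat set set). card V = n \<and> critical r V E \<and> real (card E) \<le> B"
        using composed_critical[OF lin C0 t0 tr, of m n B] tm(1) mn(1) by (simp add: K_def mult.commute)
    qed
  qed
  moreover have "C > 0" using K by (simp add: C_def)
  ultimately show ?thesis by blast
qed

end
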